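(* Let $G=(V,E)$ be a $4$-Steiner power. Then there exists a $4$-Steiner root $T$ of $G$ such that for every clique-intersection $X$ of $G$: (1) every $X$-free vertex is a leaf of $T\langle X\rangle$ whose eccentricity in $T\langle X\rangle$ equals $\mathrm{diam}(T\langle X\rangle)$; (2) there is a node $c\in\mathcal{C}(T\langle X\rangle)$ such that for every $X$-free vertex $v$, except possibly one, $\mathrm{dist}_T(v,c)=\mathrm{dist}_T(v,\mathcal{C}(T\langle X\rangle))$; (3) all internal nodes of a path between $\mathcal{C}(T\langle X\rangle)$ and an $X$-free vertex are Steiner nodes of degree two (in $T$); (4) if $X$ is a maximal clique of $G$ and $X$ contains an $X$-free vertex, then $\mathrm{diam}(T\langle X\rangle)=4$.
   Context: A $4$-Steiner power is a graph $G=(V,E)$ having a $4$-Steiner root: a tree $T$ with $V\subseteq V(T)$ such that for distinct $u,v\in V$, $uv\in E$ iff $\mathrm{dist}_T(u,v)\le 4$. Nodes of $T$ in $V$ are real, the others Steiner. For nonempty $X\subseteq V(T)$, $T\langle X\rangle$ is the smallest subtree of $T$ containing $X$; $\mathcal{C}(T')$ denotes the center (nodes of minimum eccentricity) of a tree $T'$. A clique-intersection of $G$ is a nonempty intersection of one or more maximal cliques of $G$. For a clique-intersection $X$, a vertex $v\in X$ is $X$-constrained if either (a) there is a clique-intersection $X'\subsetneq X$ with $v\in X'$ and $|X'|\ge 2$, or (b) there are clique-intersections $X_1,X_2$ with $X\subsetneq X_1$ and $X\cap X_2=\{v\}\subsetneq X_1\cap X_2$. A vertex $v\in X$ that is not $X$-constrained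 is $X$-free.
   Formalization: Part (4) is claimed only for maximal cliques X with at least two vertices, since for an isolated vertex v the clique X={v} has an X-free vertex but diam(T⟨X⟩)=0; in (1) the node of a one-node tree counts as a leaf. *)

theory Defs
  imports Main "HOL-Library.Infinite_Typeclass"
begin

section \<open>Finite simple graphs and trees\<close>

type_synonym 'a ugraph = "'a set \<times> 'a set set"

abbreviation gverts :: "'a ugraph \<Rightarrow> 'a set" where
  "gverts G \<equiv> fst G"

abbreviation gedges :: "'a ugraph \<Rightarrow> 'a set set" where
  "gedges G \<equiv> snd G"

definition simple_graph :: "'a ugraph \<Rightarrow> bool" where
  "simple_graph G \<longleftrightarrow>
     finite (gverts G) \<and> (\<forall>e\<in>gedges G. e \<subseteq> gverts G \<and> card e = 2)"

definition gdegree :: "'a ugraph \<Rightarrow> 'a \<Rightarrow> nat" where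
  "gdegree G v = card {u \<in> gverts G. {v, u} \<in> gedges G}"

text \<open>Walks are given by their nonempty lists of vertices.\<close>

definition gwalk :: "'a ugraph \<Rightarrow> 'a list \<Rightarrow> bool" where
  "gwalk G p \<longleftrightarrow>
     p \<noteq> [] \<and> set p \<subseteq> gverts G \<and> successively (\<lambda>u v. {u, v} \<in> gedges G) p"

definition gpath :: "'a ugraph \<Rightarrow> 'a list \<Rightarrow> bool" where
  "gpath G p \<longleftrightarrow> gwalk G p \<and> distinct p"

definition gcycle :: "'a ugraph \<Rightarrow> 'a list \<Rightarrow> bool" where
  "gcycle G p \<longleftrightarrow> gpath G p \<and> length p \<ge> 3 \<and> {last p, hd p} \<in> gedges G"

definition gconnected :: "'a ugraph \<Rightarrow> bool" where
  "gconnected G \<longleftrightarrow>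
     gverts G \<noteq> {} \<and>
     (\<forall>u\<in>gverts G. \<forall>v\<in>gverts G. \<exists>p. gwalk G p \<and> hd p = u \<and> last p = v)"

definition gtree :: "'a ugraph \<Rightarrow> bool" where
  "gtree T \<longleftrightarrow> simple_graph T \<and> gconnected T \<and> (\<nexists>p. gcycle T p)"

text \<open>The distances below are only meaningful in a connected graph (here: a tree).\<close>

definition gdist :: "'a ugraph \<Rightarrow> 'a \<Rightarrow> 'a \<Rightarrow> nat" where
  "gdist G u v = (LEAST n. \<exists>p. gwalk G p \<and> hd p = u \<and> last p = v \<and> length p = Suc n)"

definition gdist_set :: "'a ugraph \<Rightarrow> 'a \<Rightarrow> 'a set \<Rightarrow> nat" where
  "gdist_set G v S = Min (gdist G v ` S)"

definition gecc :: "'a ugraph \<Rightarrow> 'a \<Rightarrow> nat" where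
  "gecc G v = Max (gdist G v ` gverts G)"

definition gdiam :: "'a ugraph \<Rightarrow> nat" where
  "gdiam G = Max (gecc G ` gverts G)"

definition gcenter :: "'a ugraph \<Rightarrow> 'a set" where
  "gcenter G = {c \<in> gverts G. \<forall>v\<in>gverts G. gecc G c \<le> gecc G v}"

text \<open>The single node of a one-node tree counts as a leaf, hence degree at most one.\<close>

definition gleaf :: "'a ugraph \<Rightarrow> 'a \<Rightarrow> bool" where
  "gleaf T v \<longleftrightarrow> v \<in> gverts T \<and> gdegree T v \<le> 1"

definition subgraph_of :: "'a ugraph \<Rightarrow> 'a ugraph \<Rightarrow> bool" where
  "subgraph_of H G \<longleftrightarrow> gverts H \<subseteq> gverts G \<and> gedges H \<subseteq> gedges G"

definition subtree_of :: "'a ugraph \<Rightarrow> 'a ugraph \<Rightarrow> bool" where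
  "subtree_of S T \<longleftrightarrow> gtree S \<and> subgraph_of S T"

text \<open>\<open>T\<langle>X\<rangle>\<close>, the smallest subtree of the tree \<open>T\<close> containing the nonempty node set \<open>X\<close>.\<close>

definition spanned_subtree :: "'a ugraph \<Rightarrow> 'a set \<Rightarrow> 'a ugraph" where
  "spanned_subtree T X =
     (THE S. subtree_of S T \<and> X \<subseteq> gverts S \<and>
        (\<forall>S'. subtree_of S' T \<and> X \<subseteq> gverts S' \<longrightarrow> subgraph_of S S'))"


section \<open>Steiner powers and Steiner roots\<close>

text \<open>
  A root lives on the same type as the graph, so that the inclusion of the vertices of \<open>G\<close>
  in the nodes of \<open>T\<close> is literal. The type should be infinite, as otherwise
  it may contain too few further elements to serve as Steiner nodes.
\<close>

definition steiner_root :: "nat \<Rightarrow> 'a ugraph \<Rightarrow> 'a ugraph \<Rightarrow> bool" where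
  "steiner_root k G T \<longleftrightarrow>
     gtree T \<and> gverts G \<subseteq> gverts T \<and>
     (\<forall>u\<in>gverts G. \<forall>v\<in>gverts G. u \<noteq> v \<longrightarrow> ({u, v} \<in> gedges G \<longleftrightarrow> gdist T u v \<le> k))"

definition steiner_power :: "nat \<Rightarrow> 'a ugraph \<Rightarrow> bool" where
  "steiner_power k G \<longleftrightarrow> simple_graph G \<and> (\<exists>T. steiner_root k G T)"

definition steiner_node :: "'a ugraph \<Rightarrow> 'a ugraph \<Rightarrow> 'a \<Rightarrow> bool" where
  "steiner_node G T x \<longleftrightarrow> x \<in> gverts T - gverts G"


section \<open>Clique-intersections, constrained and free vertices\<close>

definition clique :: "'a ugraph \<Rightarrow> 'a set \<Rightarrow> bool" where
  "clique G K \<longleftrightarrow>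
     K \<subseteq> gverts G \<and> (\<forall>u\<in>K. \<forall>v\<in>K. u \<noteq> v \<longrightarrow> {u, v} \<in> gedges G)"

definition maximal_clique :: "'a ugraph \<Rightarrow> 'a set \<Rightarrow> bool" where
  "maximal_clique G K \<longleftrightarrow> clique G K \<and> (\<forall>K'. clique G K' \<and> K \<subseteq> K' \<longrightarrow> K' = K)"

definition clique_intersection :: "'a ugraph \<Rightarrow> 'a set \<Rightarrow> bool" where
  "clique_intersection G X \<longleftrightarrow>
     X \<noteq> {} \<and> (\<exists>F. F \<noteq> {} \<and> (\<forall>K\<in>F. maximal_clique G K) \<and> X = \<Inter>F)"

definition constrained_vertex :: "'a ugraph \<Rightarrow> 'a set \<Rightarrow> 'a \<Rightarrow> bool" where
  "constrained_vertex G X v \<longleftrightarrow>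
     v \<in> X \<and>
     ((\<exists>X'. clique_intersection G X' \<and> X' \<subset> X \<and> v \<in> X' \<and> card X' \<ge> 2) \<or>
      (\<exists>X1 X2. clique_intersection G X1 \<and> clique_intersection G X2 \<and>
         X \<subset> X1 \<and> X \<inter> X2 = {v} \<and> {v} \<subset> X1 \<inter> X2))"

definition free_vertex :: "'a ugraph \<Rightarrow> 'a set \<Rightarrow> 'a \<Rightarrow> bool" where
  "free_vertex G X v \<longleftrightarrow> v \<in> X \<and> \<not> constrained_vertex G X v"

end

theory Submission
  imports Defs
begin

text \<open>
  A tree is handled through its integer metric, characterised by the four-point condition, parity
  of perimeters and geodesics. A vertex \<open>v\<close> that is free in \<open>X \<noteq> {v}\<close> separates the component
  containing \<open>X - {v}\<close> from the rest of \<open>G\<close>, so that component of a root can be detached from \<open>v\<close>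
  and hung at any node \<open>c\<close> by a path of length \<open>l\<close>; this gives a root again as soon as no distance
  from \<open>v\<close> drops and the neighbours of \<open>v\<close> on that side stay within distance four. The required
  root minimises lexicographically the number of real pairs at distance one, then maximises those
  at distance four, then those at distance two, and finally minimises the excess degree of the
  Steiner nodes. Pushing \<open>v\<close> away gives (1), (4) and the Steiner part of (3); exchanging a free
  vertex between the two center nodes in both directions gives (2); the last criterion gives the
  degree part of (3).
\<close>

section \<open>Tree metrics\<close>

text \<open>The obstacle is that a component of \<open>G - v\<close> need not be carried by a part
  of the tree: its vertices may hang on Steiner nodes that other vertices use as well. In terms of
  metrics, copies, joins and subtrees are given by formulas, and comparing paths becomes an instance
  of the four-point condition with a parity count.

  The order of the criteria is dictated by the moves. Pushing \<open>v\<close> away lowers no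
  distance from it, so pairs at distance one can only disappear and pairs at distance four only
  appear; at an optimum neither happens. An exchange between center nodes is not monotone; when both
  counts tie, the pairs at distance two decide in favour of the center node that has more vertices
  next to it. The degree move preserves all real distances up to four, so its criterion comes
  last.\<close>

locale tree_metric =
  fixes N :: "'a set" and d :: "'a \<Rightarrow> 'a \<Rightarrow> nat"
  assumes finite_nodes: "finite N" and nodes_nonempty: "N \<noteq> {}"
    and zero_iff: "\<lbrakk>x \<in> N; y \<in> N\<rbrakk> \<Longrightarrow> d x y = 0 \<longleftrightarrow> x = y"
    and sym: "\<lbrakk>x \<in> N; y \<in> N\<rbrakk> \<Longrightarrow> d x y = d y x"
    and parity: "\<lbrakk>x \<in> N; y \<in> N; z \<in> N\<rbrakk> \<Longrightarrow> even (d x y + d y z + d x z)"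
    and four_point: "\<lbrakk>x \<in> N; y \<in> N; z \<in> N; w \<in> N\<rbrakk> \<Longrightarrow>
      d x y + d z w \<le> d x z + d y w \<or> d x y + d z w \<le> d x w + d y z"
    and geodesic: "\<lbrakk>x \<in> N; y \<in> N; x \<noteq> y\<rbrakk> \<Longrightarrow> \<exists>z\<in>N. d x z = 1 \<and> d x y = Suc (d z y)"

definition metric_graph :: "'a set \<Rightarrow> ('a \<Rightarrow> 'a \<Rightarrow> nat) \<Rightarrow> 'a ugraph" where
  "metric_graph N d = (N, {{x, y} |x y. x \<in> N \<and> y \<in> N \<and> d x y = 1})"

context tree_metric
begin

lemma refl [simp]: "x \<in> N \<Longrightarrow> d x x = 0"
  using zero_iff by blast

lemma triangle: "\<lbrakk>x \<in> N; y \<in> N; z \<in> N\<rbrakk> \<Longrightarrow> d x y \<le> d x z + d z y"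
  using four_point[of x y z z] sym[of z y] by simp

lemma between:
  assumes "x \<in> N" "y \<in> N" "k \<le> d x y"
  shows "\<exists>z\<in>N. d x z = k \<and> k + d z y = d x y"
  using assms(3)
proof (induction k)
  case 0
  then show ?case using assms by (intro bexI[of _ x]) auto
next
  case (Suc k)
  then obtain z where z: "z \<in> N" "d x z = k" "k + d z y = d x y" by auto
  then have "z \<noteq> y" using Suc.prems assms by auto
  then obtain w where w: "w \<in> N" "d z w = 1" "d z y = Suc (d w y)"
    using geodesic[of z y] z assms by auto
  have "d x w \<le> Suc k" using triangle[of x w z] z w assms by simp
  moreover have "d x y \<le> d x w + d w y" using triangle w assms by simp
  ultimately show ?case using z w by (intro bexI[of _ w]) auto
qed

lemma mem_metric_graph_edges:
  assumes "x \<in> N" "y \<in> N"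
  shows "{x, y} \<in> gedges (metric_graph N d) \<longleftrightarrow> d x y = 1"
  using assms sym by (auto simp: metric_graph_def doubleton_eq_iff)

lemma metric_graph_edge_nodes:
  "{x, y} \<in> gedges (metric_graph N d) \<Longrightarrow> x \<in> N \<and> y \<in> N \<and> d x y = 1"
  using sym by (auto simp: metric_graph_def doubleton_eq_iff)

lemma geodesic_walk:
  assumes "x \<in> N" "y \<in> N"
  shows "\<exists>p. gwalk (metric_graph N d) p \<and> hd p = x \<and> last p = y \<and> length p = Suc (d x y)"
  using assms(1)
proof (induction "d x y" arbitrary: x)
  case 0
  then have "x = y" using zero_iff assms by auto
  then show ?case using 0 assms
    by (intro exI[of _ "[x]"]) (auto simp: gwalk_def metric_graph_def)
next
  case (Suc n)
  then have "x \<noteq> y" using zero_iff assms by auto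
  then obtain z where z: "z \<in> N" "d x z = 1" "d x y = Suc (d z y)"
    using geodesic[of x y] Suc.prems assms by auto
  then obtain p where p: "gwalk (metric_graph N d) p" "hd p = z" "last p = y" "length p = Suc (d z y)"
    using Suc.hyps by (metis Suc_inject)
  have "{x, z} \<in> gedges (metric_graph N d)"
    using mem_metric_graph_edges Suc.prems z by auto
  then have "gwalk (metric_graph N d) (x # p)"
    using p Suc.prems by (cases p) (auto simp: gwalk_def metric_graph_def)
  then show ?case using p z by (intro exI[of _ "x # p"]) (auto simp: gwalk_def)
qed

lemma walk_dist_le:
  assumes "gwalk (metric_graph N d) p"
  shows "d (hd p) (last p) < length p"
  using assms
proof (induction p)
  case Nil
  then show ?case by (simp add: gwalk_def)
next
  case (Cons x p)
  show ?case
  proof (cases p)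
    case Nil
    then show ?thesis using Cons.prems by (simp add: gwalk_def metric_graph_def)
  next
    case (Cons z q)
    then have w: "gwalk (metric_graph N d) p" and e: "{x, z} \<in> gedges (metric_graph N d)"
      using Cons.prems by (auto simp: gwalk_def)
    have "set p \<subseteq> N" using w by (simp add: gwalk_def metric_graph_def)
    then have "last p \<in> N" "z \<in> N" "x \<in> N" "d x z = 1"
      using Cons metric_graph_edge_nodes[OF e] last_in_set[of p] by auto
    then have "d x (last p) \<le> 1 + d z (last p)" using triangle[of x "last p" z] by simp
    then show ?thesis using Cons.IH[OF w] Cons by auto
  qed
qed

lemma gdist_metric_graph:
  assumes "x \<in> N" "y \<in> N"
  shows "gdist (metric_graph N d) x y = d x y"
  unfolding gdist_def
proof (rule Least_equality)
  show "\<exists>p. gwalk (metric_graph N d) p \<and> hd p = x \<and> last p = y \<and> length p = Suc (d x y)"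
    using geodesic_walk assms by blast
  show "d x y \<le> n" if "\<exists>p. gwalk (metric_graph N d) p \<and> hd p = x \<and> last p = y \<and> length p = Suc n" for n
    using that walk_dist_le by fastforce
qed

text \<open>Take the node \<open>x\<close> of the cycle farthest from its first node
  \<open>b\<close>. By parity both neighbours \<open>y\<close>, \<open>z\<close> of \<open>x\<close>
  on the cycle are strictly nearer to \<open>b\<close>, and they are at distance at least two from
  each other, which contradicts the four-point condition for \<open>b, x, y, z\<close>.\<close>

lemma no_metric_cycle: "\<not> gcycle (metric_graph N d) p"
proof
  assume "gcycle (metric_graph N d) p"
  then have dis: "distinct p" and len: "length p \<ge> 3" and sub: "set p \<subseteq> N"
    and suc: "successively (\<lambda>u v. {u, v} \<in> gedges (metric_graph N d)) p"
    and cl: "{last p, hd p} \<in> gedges (metric_graph N d)"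
    by (auto simp: gcycle_def gpath_def gwalk_def metric_graph_def)
  define b where "b = p ! 0"
  have pN: "p ! i \<in> N" if "i < length p" for i using sub that by auto
  have bN: "b \<in> N" using pN[of 0] len by (cases p) (auto simp: b_def)
  have step: "d (p ! i) (p ! Suc i) = 1" if "Suc i < length p" for i
    using suc that metric_graph_edge_nodes by (auto simp: successively_conv_nth)
  have close: "d (p ! (length p - 1)) b = 1"
    using metric_graph_edge_nodes[OF cl] len
    by (cases "p = []") (auto simp: b_def last_conv_nth hd_conv_nth)
  let ?I = "(\<lambda>j. d b (p ! j)) ` {..<length p}"
  have I: "finite ?I" "?I \<noteq> {}" using len by (auto simp: lessThan_empty_iff)
  obtain i where i: "i < length p" "Max ?I = d b (p ! i)" using Max_in[OF I] by auto
  then have mx: "d b (p ! j) \<le> d b (p ! i)" if "j < length p" for j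
    using Max_ge[OF I(1), of "d b (p ! j)"] that by auto
  have "p ! 1 \<noteq> b" using nth_eq_iff_index_eq[OF dis, of 1 0] len unfolding b_def by linarith
  then have "d b (p ! 1) \<noteq> 0" using zero_iff bN pN[of 1] len by auto
  then have "d b (p ! i) \<noteq> 0" using mx[of 1] len by auto
  then have i0: "i \<noteq> 0" using refl[OF bN] unfolding b_def by metis
  \<comment> \<open>The cyclic successor of \<open>x\<close>: after the last index the cycle
    continues at \<open>b\<close>. A length of at least three keeps it distinct from the predecessor
    \<open>y\<close>.\<close>
  define z where "z = (if Suc i < length p then p ! Suc i else b)"
  define y where "y = p ! (i - 1)"
  define x where "x = p ! i"
  have zk: "\<exists>k < length p. z = p ! k \<and> k \<noteq> i - 1"
  proof (cases "Suc i < length p")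
    case False
    then have "i = length p - 1" using i by auto
    then show ?thesis using False len by (intro exI[of _ 0]) (auto simp: z_def b_def)
  qed (auto simp: z_def)
  then have zy: "z \<noteq> y" using nth_eq_iff_index_eq[OF dis] i by (auto simp: y_def)
  have N: "x \<in> N" "y \<in> N" "z \<in> N" using pN i zk by (auto simp: x_def y_def)
  have xy: "d x y = 1" using step[of "i - 1"] i i0 N sym[of x y] by (simp add: x_def y_def)
  have xz: "d x z = 1"
  proof (cases "Suc i < length p")
    case False
    then have "i = length p - 1" using i by auto
    then show ?thesis using close False by (auto simp: x_def z_def)
  qed (auto simp: z_def x_def step)
  have m: "d b y \<le> d b x" "d b z \<le> d b x"
    using mx i zk by (auto simp: x_def y_def)
  have "even (d b x + 1 + d b y)" "even (d b x + 1 + d b z)"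
    using parity[of b x y] parity[of b x z] xy xz bN N by auto
  then have lt: "d b y < d b x" "d b z < d b x" using m by presburger+
  have "d y z \<noteq> 0" using zy zero_iff N by auto
  moreover have "even (d y z)" using parity[of y x z] xy xz N sym[of x y] by auto
  ultimately have "d y z \<ge> 2" by presburger
  then show False using four_point[of b x y z] lt xy xz N bN by auto
qed

lemma gtree_metric_graph: "gtree (metric_graph N d)"
proof -
  have "simple_graph (metric_graph N d)"
    unfolding simple_graph_def
  proof (intro conjI ballI)
    fix e assume "e \<in> gedges (metric_graph N d)"
    then obtain x y where e: "e = {x, y}" "x \<in> N" "y \<in> N" "d x y = 1"
      by (auto simp: metric_graph_def)
    then have "x \<noteq> y" by auto
    then show "card e = 2" "e \<subseteq> gverts (metric_graph N d)"
      using e by (auto simp: metric_graph_def)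
  qed (use finite_nodes in \<open>simp add: metric_graph_def\<close>)
  moreover have "gconnected (metric_graph N d)"
    unfolding gconnected_def using nodes_nonempty geodesic_walk by (auto simp: metric_graph_def)
  ultimately show ?thesis using no_metric_cycle by (auto simp: gtree_def)
qed

lemma tree_metric_convex:
  assumes "M \<subseteq> N" "M \<noteq> {}"
    and "\<And>x y z. \<lbrakk>x \<in> M; y \<in> M; z \<in> N; d x z + d z y = d x y\<rbrakk> \<Longrightarrow> z \<in> M"
  shows "tree_metric M d"
proof
  show "finite M" using assms(1) finite_nodes finite_subset by blast
  show "\<exists>z\<in>M. d x z = 1 \<and> d x y = Suc (d z y)" if xy: "x \<in> M" "y \<in> M" "x \<noteq> y" for x y
  proof -
    have "x \<in> N" "y \<in> N" using xy assms(1) by auto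
    then obtain z where "z \<in> N" "d x z = 1" "d x y = Suc (d z y)"
      using geodesic[of x y] xy by auto
    then show ?thesis using assms(3)[of x y z] xy by (intro bexI[of _ z]) auto
  qed
next
  have sub: "x \<in> N" if "x \<in> M" for x using that assms(1) by blast
  show "d x y = 0 \<longleftrightarrow> x = y" if "x \<in> M" "y \<in> M" for x y using that sub zero_iff by simp
  show "d x y = d y x" if "x \<in> M" "y \<in> M" for x y using that sub sym by simp
  show "even (d x y + d y z + d x z)" if "x \<in> M" "y \<in> M" "z \<in> M" for x y z
    using that sub parity[of x y z] by blast
  show "d x y + d z w \<le> d x z + d y w \<or> d x y + d z w \<le> d x w + d y z"
    if "x \<in> M" "y \<in> M" "z \<in> M" "w \<in> M" for x y z w
    using that sub four_point[of x y z w] by blast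
qed (use assms(2) in auto)

lemma tree_metric_image:
  assumes f: "inj_on f N"
  shows "tree_metric (f ` N) (\<lambda>x y. d (inv_into N f x) (inv_into N f y))"
proof
  show "finite (f ` N)" "f ` N \<noteq> {}" using finite_nodes nodes_nonempty by auto
  show "\<exists>z\<in>f ` N. d (inv_into N f x) (inv_into N f z) = 1 \<and>
      d (inv_into N f x) (inv_into N f y) = Suc (d (inv_into N f z) (inv_into N f y))"
    if xy: "x \<in> f ` N" "y \<in> f ` N" "x \<noteq> y" for x y
  proof -
    obtain u v where "u \<in> N" "v \<in> N" "x = f u" "y = f v" using xy by auto
    then show ?thesis using geodesic[of u v] xy f by auto
  qed
next
  show "even (d (inv_into N f x) (inv_into N f y) + d (inv_into N f y) (inv_into N f z)
      + d (inv_into N f x) (inv_into N f z))"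
    if "x \<in> f ` N" "y \<in> f ` N" "z \<in> f ` N" for x y z
    using that by (intro parity) (auto intro: inv_into_into)
  show "d (inv_into N f x) (inv_into N f y) + d (inv_into N f z) (inv_into N f w)
      \<le> d (inv_into N f x) (inv_into N f z) + d (inv_into N f y) (inv_into N f w) \<or>
    d (inv_into N f x) (inv_into N f y) + d (inv_into N f z) (inv_into N f w)
      \<le> d (inv_into N f x) (inv_into N f w) + d (inv_into N f y) (inv_into N f z)"
    if "x \<in> f ` N" "y \<in> f ` N" "z \<in> f ` N" "w \<in> f ` N" for x y z w
    using that by (intro four_point) (auto intro: inv_into_into)
qed (use f in \<open>auto simp: zero_iff sym inj_on_eq_iff\<close>)

end

lemma tree_metric_cong:
  assumes "tree_metric N d" "\<And>x y. \<lbrakk>x \<in> N; y \<in> N\<rbrakk> \<Longrightarrow> d' x y = d x y"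
  shows "tree_metric N d'"
proof -
  interpret tree_metric N d by fact
  show ?thesis
    by unfold_locales (use finite_nodes nodes_nonempty zero_iff sym parity four_point geodesic assms(2) in auto)
qed

section \<open>Joining two trees by an edge\<close>

definition join_metric ::
  "'a set \<Rightarrow> ('a \<Rightarrow> 'a \<Rightarrow> nat) \<Rightarrow> 'a \<Rightarrow> ('a \<Rightarrow> 'a \<Rightarrow> nat) \<Rightarrow> 'a \<Rightarrow> 'a \<Rightarrow> 'a \<Rightarrow> nat" where
  "join_metric M d1 a d2 b x y =
    (if x \<in> M then if y \<in> M then d1 x y else Suc (d1 x a + d2 b y)
     else if y \<in> M then Suc (d1 y a + d2 b x) else d2 x y)"

text \<open>Every path that changes sides runs through the edge \<open>ab\<close>, so seen from one
  side a node of the other acts like \<open>a\<close> or \<open>b\<close>, up to a constant. In the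
  four-point condition this constant cancels, which leaves an instance on one side or two triangle
  inequalities through \<open>a\<close> and \<open>b\<close>.\<close>

lemma tree_metric_join:
  assumes t1: "tree_metric M d1" and t2: "tree_metric M' d2"
    and disj: "M \<inter> M' = {}" and a: "a \<in> M" and b: "b \<in> M'"
  shows "tree_metric (M \<union> M') (join_metric M d1 a d2 b)" (is "tree_metric _ ?D")
proof -
  interpret A: tree_metric M d1 by fact
  interpret B: tree_metric M' d2 by fact
  note tri = A.triangle[of _ _ a] B.triangle[of _ _ b]
  have nd: "x \<notin> M" if "x \<in> M'" for x using that disj by auto
  have E1: "?D x y = d1 x y" if "x \<in> M" "y \<in> M" for x y using that by (simp add: join_metric_def)
  have E2: "?D x y = d2 x y" if "x \<in> M'" "y \<in> M'" for x y using that nd by (simp add: join_metric_def)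
  have E3: "?D x y = Suc (d1 x a + d2 y b)" if "x \<in> M" "y \<in> M'" for x y
    using that nd B.sym b by (simp add: join_metric_def)
  have E4: "?D x y = Suc (d1 y a + d2 x b)" if "x \<in> M'" "y \<in> M" for x y
    using that nd B.sym b by (simp add: join_metric_def)
  note D = E1 E2 E3 E4
  show ?thesis
  proof
    show "finite (M \<union> M')" "M \<union> M' \<noteq> {}" using A.finite_nodes B.finite_nodes a by auto
    show "?D x y = 0 \<longleftrightarrow> x = y" if "x \<in> M \<union> M'" "y \<in> M \<union> M'" for x y
      using that nd by (auto simp: D A.zero_iff B.zero_iff)
    show "?D x y = ?D y x" if "x \<in> M \<union> M'" "y \<in> M \<union> M'" for x y
      using that by (auto simp: D A.sym B.sym)
    show "even (?D x y + ?D y z + ?D x z)"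
      if "x \<in> M \<union> M'" "y \<in> M \<union> M'" "z \<in> M \<union> M'" for x y z
      using that A.parity[of x y z] B.parity[of x y z]
        A.parity[of x y a] B.parity[of x y b] A.parity[of x z a] B.parity[of x z b]
        A.parity[of y z a] B.parity[of y z b] a b
      by (elim UnE) (simp_all add: D A.sym[of a] B.sym[of b], presburger+)
    show "\<exists>z\<in>M \<union> M'. ?D x z = 1 \<and> ?D x y = Suc (?D z y)"
      if xy: "x \<in> M \<union> M'" "y \<in> M \<union> M'" "x \<noteq> y" for x y
    proof -
      consider "x \<in> M" "y \<in> M" | "x \<in> M'" "y \<in> M'" | "x \<in> M" "y \<in> M'" | "x \<in> M'" "y \<in> M"
        using xy by blast
      then show ?thesis
      proof cases
        case 1
        then obtain z where "z \<in> M" "d1 x z = 1" "d1 x y = Suc (d1 z y)"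
          using A.geodesic[of x y] xy by auto
        then show ?thesis using 1 by (intro bexI[of _ z]) (auto simp: D)
      next
        case 2
        then obtain z where "z \<in> M'" "d2 x z = 1" "d2 x y = Suc (d2 z y)"
          using B.geodesic[of x y] xy by auto
        then show ?thesis using 2 by (intro bexI[of _ z]) (auto simp: D)
      next
        case 3
        show ?thesis
        proof (cases "x = a")
          case True
          then show ?thesis using 3 a b by (intro bexI[of _ b]) (auto simp: D B.sym)
        next
          case False
          then obtain z where "z \<in> M" "d1 x z = 1" "d1 x a = Suc (d1 z a)"
            using A.geodesic[of x a] 3 a by auto
          then show ?thesis using 3 by (intro bexI[of _ z]) (auto simp: D)
        qed
      next
        case 4
        show ?thesis
        proof (cases "x = b")
          case True
          then show ?thesis using 4 a b by (intro bexI[of _ a]) (auto simp: D A.sym)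
        next
          case False
          then obtain z where "z \<in> M'" "d2 x z = 1" "d2 x b = Suc (d2 z b)"
            using B.geodesic[of x b] 4 b by auto
          then show ?thesis using 4 by (intro bexI[of _ z]) (auto simp: D)
        qed
      qed
    qed
    show "?D x y + ?D z w \<le> ?D x z + ?D y w \<or> ?D x y + ?D z w \<le> ?D x w + ?D y z"
      if m: "x \<in> M \<union> M'" "y \<in> M \<union> M'" "z \<in> M \<union> M'" "w \<in> M \<union> M'" for x y z w
    proof -
      have MM: "?D x y + ?D z w \<le> ?D x z + ?D y w \<or> ?D x y + ?D z w \<le> ?D x w + ?D y z"
        if "x \<in> M" "y \<in> M" "z \<in> M \<union> M'" "w \<in> M \<union> M'" for x y z w
        using that(3,4)
      proof (elim UnE)
        assume "z \<in> M" "w \<in> M"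
        then show ?thesis using A.four_point[of x y z w] that by (simp add: D)
      next
        assume "z \<in> M" "w \<in> M'"
        then show ?thesis using A.four_point[of x y z a] that a by (simp add: D)
      next
        assume "z \<in> M'" "w \<in> M"
        then show ?thesis using A.four_point[of x y a w] that a A.sym[of a w] by (simp add: D)
      next
        assume "z \<in> M'" "w \<in> M'"
        then show ?thesis
          using A.triangle[of x y a] A.sym[of a y] B.triangle[of z w b] B.sym[of b w] that a b
          by (simp add: D)
      qed
      have NN: "?D x y + ?D z w \<le> ?D x z + ?D y w \<or> ?D x y + ?D z w \<le> ?D x w + ?D y z"
        if "x \<in> M'" "y \<in> M'" "z \<in> M \<union> M'" "w \<in> M \<union> M'" for x y z w
        using that(3,4)
      proof (elim UnE)
        assume "z \<in> M'" "w \<in> M'"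
        then show ?thesis using B.four_point[of x y z w] that by (simp add: D)
      next
        assume "z \<in> M'" "w \<in> M"
        then show ?thesis using B.four_point[of x y z b] that b by (simp add: D)
      next
        assume "z \<in> M" "w \<in> M'"
        then show ?thesis using B.four_point[of x y b w] that b B.sym[of b w] by (simp add: D)
      next
        assume "z \<in> M" "w \<in> M"
        then show ?thesis
          using B.triangle[of x y b] B.sym[of b y] A.triangle[of z w a] A.sym[of a w] that a b
          by (simp add: D)
      qed
      \<comment> \<open>When \<open>z\<close> and \<open>w\<close> lie on different sides as well,
        one of the two sums on the right equals the left one, so computing settles these
        cases.\<close>
      have MN: "?D x y + ?D z w \<le> ?D x z + ?D y w \<or> ?D x y + ?D z w \<le> ?D x w + ?D y z"
        if "x \<in> M" "y \<in> M'" "z \<in> M \<union> M'" "w \<in> M \<union> M'" for x y z w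
        using that(3,4)
      proof (elim UnE)
        assume "z \<in> M" "w \<in> M"
        then show ?thesis
          using A.four_point[of x a z w] that a A.sym[of a w] A.sym[of a z] by (simp add: D)
      next
        assume "z \<in> M'" "w \<in> M'"
        then show ?thesis
          using B.four_point[of y b z w] that b B.sym[of b w] B.sym[of b z] by (auto simp: D)
      qed (use that in \<open>simp_all add: D\<close>)
      have sD: "?D x y = ?D y x" if "x \<in> M \<union> M'" "y \<in> M \<union> M'" for x y
        using that by (auto simp: D A.sym B.sym)
      have NM: "?D x y + ?D z w \<le> ?D x z + ?D y w \<or> ?D x y + ?D z w \<le> ?D x w + ?D y z"
        if "x \<in> M'" "y \<in> M" "z \<in> M \<union> M'" "w \<in> M \<union> M'" for x y z w
        using MN[of y x z w] sD[of x y] that by auto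
      show ?thesis
        using m(1,2) MM[OF _ _ m(3,4), of x y] NN[OF _ _ m(3,4), of x y]
          MN[OF _ _ m(3,4), of x y] NM[OF _ _ m(3,4), of x y] by (elim UnE)
    qed
  qed
qed

lemma tree_metric_singleton: "tree_metric {x} (\<lambda>_ _. 0)"
  by unfold_locales auto

section \<open>Graph-theoretic trees as tree metrics\<close>

lemma gtree_edgeD:
  assumes "gtree T" "{x, y} \<in> gedges T"
  shows "x \<in> gverts T" "y \<in> gverts T" "x \<noteq> y"
proof -
  have "{x, y} \<subseteq> gverts T \<and> card {x, y} = 2"
    using assms by (auto simp: gtree_def simple_graph_def)
  then show "x \<in> gverts T" "y \<in> gverts T" "x \<noteq> y" by auto
qed

text \<open>The start of a longest path: by maximality its neighbours lie on the path, and a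
  neighbour beyond the second node would close a cycle.\<close>

lemma gtree_leaf_exists:
  assumes T: "gtree T" and c: "card (gverts T) \<ge> 2"
  shows "\<exists>x y. x \<in> gverts T \<and> {x, y} \<in> gedges T \<and> (\<forall>z. {x, z} \<in> gedges T \<longrightarrow> z = y)"
proof -
  have fin: "finite (gverts T)" and ne: "gverts T \<noteq> {}"
    and con: "\<And>u v. \<lbrakk>u \<in> gverts T; v \<in> gverts T\<rbrakk> \<Longrightarrow> \<exists>p. gwalk T p \<and> hd p = u \<and> last p = v"
    and acyc: "\<And>p. \<not> gcycle T p"
    using T by (auto simp: gtree_def simple_graph_def gconnected_def)
  let ?P = "{p. gpath T p}"
  have "?P \<subseteq> {p. set p \<subseteq> gverts T \<and> length p \<le> card (gverts T)}"
    using fin by (auto simp: gpath_def gwalk_def) (metis card_mono distinct_card)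
  then have finP: "finite ?P" using finite_lists_length_le[OF fin] finite_subset by blast
  obtain u where "u \<in> gverts T" using ne by auto
  then have "[u] \<in> ?P" by (auto simp: gpath_def gwalk_def)
  then have L: "finite (length ` ?P)" "length ` ?P \<noteq> {}" using finP by auto
  obtain p where p: "gpath T p" "length p = Max (length ` ?P)" using Max_in[OF L] by auto
  have long: "length q \<le> length p" if "gpath T q" for q
    using Max_ge[OF L(1), of "length q"] p that by auto
  obtain x q where xq: "p = x # q" using p by (cases p) (auto simp: gpath_def gwalk_def)
  have x: "x \<in> gverts T" using p xq by (auto simp: gpath_def gwalk_def)
  have nb: "z \<in> set q" if z: "{x, z} \<in> gedges T" for z
  proof (rule ccontr)
    assume "z \<notin> set q"
    then have "gpath T (z # p)"
      using p xq z gtree_edgeD[OF T z] by (auto simp: gpath_def gwalk_def insert_commute)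
    then show False using long by fastforce
  qed
  obtain w where w: "w \<in> gverts T" "w \<noteq> x"
    using c by (metis card_le_Suc0_iff_eq fin le_antisym not_less_eq_eq numeral_2_eq_2 nle_le)
  then obtain r where r: "gwalk T r" "hd r = x" "last r = w" using con x by blast
  then obtain z r' where "r = x # z # r'" using w
    by (cases r rule: remdups_adj.cases) (auto simp: gwalk_def)
  then have xz: "{x, z} \<in> gedges T" using r by (auto simp: gwalk_def)
  then obtain y q' where q: "q = y # q'" using nb by (cases q) auto
  have "z = y" if z: "{x, z} \<in> gedges T" for z
  proof (rule ccontr)
    assume "z \<noteq> y"
    then have "z \<in> set q'" using nb[OF z] q by auto
    then obtain a b where ab: "q' = a @ z # b" using split_list by metis
    have "gcycle T (x # y # a @ [z])"
      using p xq q ab z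
      by (auto simp: gcycle_def gpath_def gwalk_def insert_commute successively_append_iff
          successively_Cons hd_append split: if_splits)
    then show False using acyc by blast
  qed
  moreover have "{x, y} \<in> gedges T" using p xq q by (auto simp: gpath_def gwalk_def)
  ultimately show ?thesis using x by blast
qed

text \<open>Connectedness is the point. A shortest walk between other nodes avoids the leaf
  \<open>x\<close>, since it would enter and leave it through \<open>y\<close> and could be
  shortened by omitting that detour.\<close>

lemma gtree_remove_leaf:
  assumes T: "gtree T" and e: "{x, y} \<in> gedges T" and leaf: "\<And>z. {x, z} \<in> gedges T \<Longrightarrow> z = y"
  shows "gtree (gverts T - {x}, {e \<in> gedges T. x \<notin> e})" (is "gtree ?T")
proof -
  have con: "\<And>u v. \<lbrakk>u \<in> gverts T; v \<in> gverts T\<rbrakk> \<Longrightarrow> \<exists>p. gwalk T p \<and> hd p = u \<and> last p = v"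
    and acyc: "\<And>p. \<not> gcycle T p"
    using T by (auto simp: gtree_def gconnected_def)
  note xy = gtree_edgeD[OF T e]
  have mono: "gwalk T p" if "gwalk ?T p" for p
    using that by (auto simp: gwalk_def elim: successively_mono)
  have "simple_graph ?T" using T by (auto simp: gtree_def simple_graph_def)
  moreover have "\<not> gcycle ?T p" for p
    using acyc[of p] mono[of p] by (auto simp: gcycle_def gpath_def)
  moreover have "\<exists>p. gwalk ?T p \<and> hd p = u \<and> last p = v"
    if u: "u \<in> gverts ?T" and v: "v \<in> gverts ?T" for u v
  proof -
    let ?W = "\<lambda>p. gwalk T p \<and> hd p = u \<and> last p = v"
    obtain p where p: "?W p" and min: "\<And>q. ?W q \<Longrightarrow> length p \<le> length q"
      using con[of u v] u v exists_least_iff[of "\<lambda>n. \<exists>p. ?W p \<and> length p = n"]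
      by (metis DiffD1 fst_conv not_le_imp_less)
    have "x \<notin> set p"
    proof
      assume "x \<in> set p"
      then obtain a b where ab: "p = a @ x # b" using split_list by metis
      have "a \<noteq> []" "b \<noteq> []" using ab p u v by auto
      then obtain a' l h b' where a: "a = a' @ [l]" and b: "b = h # b'"
        by (metis rev_exhaust list.exhaust)
      have "{x, l} \<in> gedges T" "{x, h} \<in> gedges T"
        using p ab a b by (auto simp: gwalk_def successively_append_iff insert_commute)
      then have "l = y" "h = y" using leaf by auto
      then have "?W (a @ b')"
        using p ab a b by (auto simp: gwalk_def successively_append_iff successively_Cons hd_append)
      then show False using min[of "a @ b'"] ab b by simp
    qed
    then have "gwalk ?T p"
      using p by (auto simp: gwalk_def successively_conv_nth)
    then show ?thesis using p by blast
  qed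
  moreover have "gverts ?T \<noteq> {}" using xy by auto
  ultimately show ?thesis by (auto simp: gtree_def gconnected_def)
qed

text \<open>Induction by deleting a leaf and joining it again as a one-node tree. It is enough to
  find some metric \<open>d\<close>, because \<open>gdist_metric_graph\<close> identifies it with
  \<open>gdist\<close> afterwards.\<close>

lemma gtree_imp_tree_metric:
  assumes "gtree T"
  shows "\<exists>d. tree_metric (gverts T) d \<and> metric_graph (gverts T) d = T"
  using assms
proof (induction "card (gverts T)" arbitrary: T rule: less_induct)
  case less
  have fin: "finite (gverts T)" and ne: "gverts T \<noteq> {}"
    and card2: "\<And>e. e \<in> gedges T \<Longrightarrow> e \<subseteq> gverts T \<and> card e = 2"
    using less.prems by (auto simp: gtree_def simple_graph_def gconnected_def)
  show ?case
  proof (cases "card (gverts T) \<ge> 2")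
    case False
    moreover have "card (gverts T) \<noteq> 0" using fin ne by auto
    ultimately have "card (gverts T) = 1" by linarith
    then obtain x where x: "gverts T = {x}" by (auto simp: card_1_singleton_iff)
    have "e \<notin> gedges T" for e
    proof
      assume "e \<in> gedges T"
      then have "e \<subseteq> {x}" "card e = 2" using card2 x by auto
      then show False using card_mono[of "{x}" e] by simp
    qed
    then have "gedges T = {}" by blast
    then have "metric_graph (gverts T) (\<lambda>_ _. 0) = T"
      using x by (auto simp: metric_graph_def prod_eq_iff)
    then show ?thesis using tree_metric_singleton x by metis
  next
    case True
    then obtain x y where xy: "x \<in> gverts T" "{x, y} \<in> gedges T"
      and leaf: "\<And>z. {x, z} \<in> gedges T \<Longrightarrow> z = y"
      using gtree_leaf_exists less.prems by metis
    define S where "S = (gverts T - {x}, {e \<in> gedges T. x \<notin> e})"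
    have "gtree S" unfolding S_def using gtree_remove_leaf[OF less.prems xy(2) leaf] .
    moreover have "card (gverts S) < card (gverts T)"
      using card_Diff1_less[OF fin xy(1)] by (simp add: S_def)
    ultimately obtain d where d: "tree_metric (gverts S) d" "metric_graph (gverts S) d = S"
      using less.hyps by blast
    interpret S: tree_metric "gverts S" d by fact
    have y: "y \<in> gverts S" using gtree_edgeD[OF less.prems xy(2)] by (auto simp: S_def)
    define D where "D = join_metric (gverts S) d y (\<lambda>_ _. 0) x"
    have un: "gverts S \<union> {x} = gverts T" using xy by (auto simp: S_def)
    have tm: "tree_metric (gverts T) D"
      using tree_metric_join[OF d(1) tree_metric_singleton[of x], of y x] y
      unfolding un[symmetric] D_def by (auto simp: S_def)
    interpret D: tree_metric "gverts T" D by fact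
    have edge: "{u, v} \<in> gedges T \<longleftrightarrow> D u v = 1" if "u \<in> gverts T" "v \<in> gverts T" for u v
    proof -
      consider "u \<noteq> x" "v \<noteq> x" | "u = x" | "v = x" "u \<noteq> x" by blast
      then show ?thesis
      proof cases
        case 1
        then have "{u, v} \<in> gedges T \<longleftrightarrow> {u, v} \<in> gedges S" by (auto simp: S_def)
        also have "\<dots> \<longleftrightarrow> d u v = 1"
          using S.mem_metric_graph_edges[of u v] d(2) that 1 by (auto simp: S_def)
        also have "d u v = D u v" using that 1 by (auto simp: D_def join_metric_def S_def)
        finally show ?thesis .
      next
        case 2
        then have "{u, v} \<in> gedges T \<longleftrightarrow> v = y" using leaf[of v] xy(2) by blast
        moreover have "D u v = 1 \<longleftrightarrow> v = y"
          using 2 that S.zero_iff[of v y] y by (auto simp: D_def join_metric_def S_def)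
        ultimately show ?thesis by simp
      next
        case 3
        then have "{u, v} \<in> gedges T \<longleftrightarrow> u = y"
          using leaf[of u] xy(2) insert_commute[of u x "{}"] by metis
        moreover have "D u v = 1 \<longleftrightarrow> u = y"
          using 3 that S.zero_iff[of u y] y by (auto simp: D_def join_metric_def S_def)
        ultimately show ?thesis by simp
      qed
    qed
    have "gedges (metric_graph (gverts T) D) = gedges T"
    proof (intro set_eqI iffI)
      fix e assume "e \<in> gedges T"
      moreover from this obtain u v where "e = {u, v}" "u \<in> gverts T" "v \<in> gverts T"
        using card2[of e] by (auto simp: card_2_iff)
      ultimately show "e \<in> gedges (metric_graph (gverts T) D)"
        using edge[of u v] by (auto simp: metric_graph_def)
    qed (use edge in \<open>auto simp: metric_graph_def\<close>)
    then show ?thesis using tm by (intro exI[of _ D]) (simp add: prod_eq_iff metric_graph_def)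
  qed
qed

lemma gtree_tree_metric:
  assumes "gtree T"
  shows "tree_metric (gverts T) (gdist T)" "metric_graph (gverts T) (gdist T) = T"
proof -
  obtain d where d: "tree_metric (gverts T) d" "metric_graph (gverts T) d = T"
    using gtree_imp_tree_metric[OF assms] by blast
  interpret tree_metric "gverts T" d by fact
  have g: "gdist T x y = d x y" if "x \<in> gverts T" "y \<in> gverts T" for x y
    using gdist_metric_graph that d(2) by metis
  show "tree_metric (gverts T) (gdist T)" using tree_metric_cong[OF d(1)] g by blast
  have "{{x, y} |x y. x \<in> gverts T \<and> y \<in> gverts T \<and> gdist T x y = 1} =
      {{x, y} |x y. x \<in> gverts T \<and> y \<in> gverts T \<and> d x y = 1}"
    using g by (metis (no_types, lifting))
  then have "metric_graph (gverts T) (gdist T) = metric_graph (gverts T) d"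
    by (simp add: metric_graph_def)
  then show "metric_graph (gverts T) (gdist T) = T" using d(2) by simp
qed

section \<open>Spanned subtrees, centers and paths\<close>

lemma successively_crossing:
  assumes "successively R p" "p \<noteq> []" "P (hd p)" "\<not> P (last p)"
  shows "\<exists>x\<in>set p. \<exists>y\<in>set p. R x y \<and> P x \<and> \<not> P y"
  using assms
proof (induction p)
  case (Cons x p)
  show ?case
  proof (cases p)
    case Nil
    then show ?thesis using Cons.prems by simp
  next
    case (Cons y q)
    show ?thesis
    proof (cases "P y")
      case True
      then show ?thesis using Cons.IH Cons.prems Cons by auto
    next
      case False
      then show ?thesis using Cons.prems Cons by auto
    qed
  qed
qed simp

context tree_metric
begin

definition convex_nodes :: "'a set \<Rightarrow> bool" where
  "convex_nodes M \<longleftrightarrow>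
     M \<subseteq> N \<and> (\<forall>x\<in>M. \<forall>y\<in>M. \<forall>z\<in>N. d x z + d z y = d x y \<longrightarrow> z \<in> M)"

definition span_nodes :: "'a set \<Rightarrow> 'a set" where
  "span_nodes X = \<Inter>{M. convex_nodes M \<and> X \<subseteq> M}"

lemma convex_nodesD:
  "\<lbrakk>convex_nodes M; x \<in> M; y \<in> M; z \<in> N; d x z + d z y = d x y\<rbrakk> \<Longrightarrow> z \<in> M"
  unfolding convex_nodes_def by blast

lemma span_nodes_least: "\<lbrakk>convex_nodes M; X \<subseteq> M\<rbrakk> \<Longrightarrow> span_nodes X \<subseteq> M"
  by (auto simp: span_nodes_def)

lemma span_nodes_superset: "X \<subseteq> span_nodes X"
  by (auto simp: span_nodes_def)

lemma convex_nodes_UNIV: "convex_nodes N"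
  by (auto simp: convex_nodes_def)

lemma convex_span_nodes:
  assumes "X \<subseteq> N"
  shows "convex_nodes (span_nodes X)"
  unfolding convex_nodes_def
proof (intro conjI ballI impI)
  show "span_nodes X \<subseteq> N" using span_nodes_least convex_nodes_UNIV assms by blast
next
  fix x y z assume a: "x \<in> span_nodes X" "y \<in> span_nodes X" "z \<in> N" "d x z + d z y = d x y"
  show "z \<in> span_nodes X"
    unfolding span_nodes_def
  proof (clarify)
    fix M assume M: "convex_nodes M" "X \<subseteq> M"
    then have "x \<in> M" "y \<in> M" using a(1,2) span_nodes_least by blast+
    then show "z \<in> M" using convex_nodesD[OF M(1)] a(3,4) by blast
  qed
qed

lemma span_nodes_subset_nodes: "X \<subseteq> N \<Longrightarrow> span_nodes X \<subseteq> N"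
  using convex_span_nodes by (simp add: convex_nodes_def)

lemma tree_metric_span_nodes:
  assumes "X \<subseteq> N" "X \<noteq> {}"
  shows "tree_metric (span_nodes X) d"
proof (rule tree_metric_convex)
  show "span_nodes X \<noteq> {}" using span_nodes_superset assms(2) by blast
qed (use convex_nodesD[OF convex_span_nodes[OF assms(1)]] span_nodes_subset_nodes[OF assms(1)] in blast)+

text \<open>As \<open>d x y\<close> splits at \<open>z\<close>, the four-point condition for
  \<open>c, z, x, y\<close> bounds \<open>d c z\<close> by \<open>d c x\<close> or
  \<open>d c y\<close>. This carries bounds on \<open>X\<close> over to its whole span.\<close>

lemma convex_nodes_ball:
  assumes "c \<in> N"
  shows "convex_nodes {z \<in> N. d c z \<le> r}"
  unfolding convex_nodes_def
proof (intro conjI ballI impI)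
  fix x y z assume a: "x \<in> {z \<in> N. d c z \<le> r}" "y \<in> {z \<in> N. d c z \<le> r}" "z \<in> N"
    "d x z + d z y = d x y"
  then show "z \<in> {z \<in> N. d c z \<le> r}"
    using four_point[of c z x y] sym[of x z] assms by auto
qed auto

lemma span_nodes_in_ball:
  assumes "c \<in> N" "X \<subseteq> N" "\<And>x. x \<in> X \<Longrightarrow> d c x \<le> r" "z \<in> span_nodes X"
  shows "d c z \<le> r"
proof -
  have "span_nodes X \<subseteq> {z \<in> N. d c z \<le> r}"
    using assms by (intro span_nodes_least convex_nodes_ball) auto
  then show ?thesis using assms(4) by auto
qed

text \<open>The strict inequality expresses that \<open>z\<close> does not separate the two ends. By
  the four-point condition this survives prepending an edge that avoids \<open>z\<close>.\<close>

lemma walk_avoiding_node: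
  assumes "gwalk (metric_graph N d) p" "z \<in> N" "z \<notin> set p"
  shows "d (hd p) (last p) < d (hd p) z + d z (last p)"
  using assms
proof (induction p)
  case Nil
  then show ?case by (simp add: gwalk_def)
next
  case (Cons x p)
  have x: "x \<in> N" "x \<noteq> z" using Cons.prems by (auto simp: gwalk_def metric_graph_def)
  show ?case
  proof (cases p)
    case Nil
    then show ?thesis using x Cons.prems zero_iff[of x z] by simp
  next
    case (Cons y q)
    then have w: "gwalk (metric_graph N d) p" and e: "{x, y} \<in> gedges (metric_graph N d)"
      using Cons.prems by (auto simp: gwalk_def)
    have y: "y \<in> N" "y \<noteq> z" "d x y = 1"
      using metric_graph_edge_nodes[OF e] Cons.prems Cons by auto
    have "set p \<subseteq> N" using w by (simp add: gwalk_def metric_graph_def)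
    then have l: "last p \<in> N" using Cons last_in_set[of p] by auto
    have "d y (last p) < d y z + d z (last p)" using Cons.IH[OF w] Cons Cons.prems by auto
    then have "d x (last p) < d x z + d z (last p)"
      using four_point[of x "last p" y z] zero_iff[of x z] zero_iff[of y z] x y l Cons.prems(2)
        sym[of "last p" z] sym[of "last p" y]
      by auto
    then show ?thesis using Cons by simp
  qed
qed

text \<open>Every tree edge is a bridge: if the nodes are sorted by the end of \<open>uw\<close> to
  which they are nearer, no other edge joins the two classes. Hence a connected subgraph containing
  both ends contains the edge itself.\<close>

lemma edge_crossing:
  assumes "x \<in> N" "y \<in> N" "u \<in> N" "w \<in> N" "d x y = 1" "d u w = 1"
    and "d x u < d x w" "\<not> d y u < d y w"
  shows "x = u \<and> y = w"
proof -
  have "d x w = Suc (d x u)" using triangle[of x w u] assms by auto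
  moreover have "d y u = Suc (d y w)"
  proof -
    have "d y u \<le> Suc (d y w)" using triangle[of y u w] sym[of u w] assms by simp
    moreover have "even (d y u + 1 + d y w)" using parity[of y u w] assms by simp
    moreover have "d y w \<le> d y u" using assms by simp
    ultimately show ?thesis by presburger
  qed
  ultimately have "d x u = 0" "d y w = 0"
    using four_point[of x w y u] sym[of w y] sym[of w u] assms by auto
  then show ?thesis using zero_iff assms by auto
qed

lemma walk_joining_edge:
  assumes p: "gwalk S p" and S: "subgraph_of S (metric_graph N d)"
    and "hd p = u" "last p = w" "d u w = 1" "u \<in> N" "w \<in> N"
  shows "{u, w} \<in> gedges S"
proof -
  obtain x y where xy: "{x, y} \<in> gedges S" "d x u < d x w" "\<not> d y u < d y w"
    using successively_crossing[of "\<lambda>u v. {u, v} \<in> gedges S" p "\<lambda>x. d x u < d x w"]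
      assms sym[of u w] by (auto simp: gwalk_def)
  then have "{x, y} \<in> gedges (metric_graph N d)" using S by (auto simp: subgraph_of_def)
  then have "x = u \<and> y = w"
    using metric_graph_edge_nodes[of x y] edge_crossing[of x y u w] xy assms by auto
  then show ?thesis using xy by simp
qed

text \<open>The nodes of any subtree are convex, because a walk cannot avoid a node between its
  ends, and it has all tree edges between its nodes, because these are bridges. So the convex hull
  carries the least subtree, which is unique by antisymmetry of \<open>subgraph_of\<close>.\<close>

lemma spanned_subtree_metric_graph:
  assumes "X \<subseteq> N" "X \<noteq> {}"
  shows "spanned_subtree (metric_graph N d) X = metric_graph (span_nodes X) d"
proof -
  interpret H: tree_metric "span_nodes X" d using tree_metric_span_nodes assms by blast
  let ?T = "metric_graph N d" and ?H = "metric_graph (span_nodes X) d"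
  let ?P = "\<lambda>S. subtree_of S ?T \<and> X \<subseteq> gverts S \<and>
    (\<forall>S'. subtree_of S' ?T \<and> X \<subseteq> gverts S' \<longrightarrow> subgraph_of S S')"
  have HN: "span_nodes X \<subseteq> N" using span_nodes_subset_nodes assms by blast
  have "subtree_of ?H ?T"
    using H.gtree_metric_graph HN by (auto simp: subtree_of_def subgraph_of_def metric_graph_def)
  moreover have "subgraph_of ?H S" if S: "subtree_of S ?T" "X \<subseteq> gverts S" for S
  proof -
    have con: "\<And>u v. \<lbrakk>u \<in> gverts S; v \<in> gverts S\<rbrakk> \<Longrightarrow> \<exists>p. gwalk S p \<and> hd p = u \<and> last p = v"
      and sub: "subgraph_of S ?T"
      using S by (auto simp: subtree_of_def gtree_def gconnected_def)
    have SN: "gverts S \<subseteq> N" using sub by (auto simp: subgraph_of_def metric_graph_def)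
    have walk: "gwalk ?T p" if "gwalk S p" for p
      using that sub by (auto simp: gwalk_def subgraph_of_def elim: successively_mono)
    have "convex_nodes (gverts S)"
      unfolding convex_nodes_def
    proof (intro conjI ballI impI)
      fix x y z assume a: "x \<in> gverts S" "y \<in> gverts S" "z \<in> N" "d x z + d z y = d x y"
      then obtain p where p: "gwalk S p" "hd p = x" "last p = y" using con by blast
      then have "z \<in> set p" using walk_avoiding_node[OF walk[OF p(1)]] a by force
      then show "z \<in> gverts S" using p by (auto simp: gwalk_def)
    qed (fact SN)
    then have HS: "span_nodes X \<subseteq> gverts S" using span_nodes_least S by blast
    have "{u, w} \<in> gedges S" if "u \<in> span_nodes X" "w \<in> span_nodes X" "d u w = 1" for u w
      using con[of u w] walk_joining_edge[OF _ sub] that HS HN by blast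
    then show ?thesis using HS by (auto simp: subgraph_of_def metric_graph_def)
  qed
  moreover have "X \<subseteq> gverts ?H" using span_nodes_superset by (simp add: metric_graph_def)
  ultimately have "?P ?H" by blast
  moreover have "S = ?H" if S: "?P S" for S
  proof -
    have "subgraph_of S ?H" "subgraph_of ?H S" using S \<open>?P ?H\<close> by blast+
    then show ?thesis unfolding subgraph_of_def prod_eq_iff by blast
  qed
  ultimately show ?thesis unfolding spanned_subtree_def by (rule the_equality)
qed

lemma gdegree_metric_graph: "v \<in> N \<Longrightarrow> gdegree (metric_graph N d) v = card {u \<in> N. d v u = 1}"
  using mem_metric_graph_edges
  by (auto simp: gdegree_def metric_graph_def intro!: arg_cong[of _ _ card])

text \<open>Otherwise \<open>x\<close> would not separate the ends of the path, and the pieces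
  before and after \<open>x\<close> would connect its path neighbours \<open>l\<close> and
  \<open>h\<close> away from \<open>x\<close>; but these are distinct neighbours of \<open>x\<close>
  and thus at distance at least two.\<close>

lemma path_between:
  assumes p: "gpath (metric_graph N d) p" and x: "x \<in> set p"
  shows "d (hd p) x + d x (last p) = d (hd p) (last p)"
proof -
  have w: "gwalk (metric_graph N d) p" and dis: "distinct p" using p by (auto simp: gpath_def)
  then have sub: "set p \<subseteq> N" by (auto simp: gwalk_def metric_graph_def)
  obtain a b where ab: "p = a @ x # b" using split_list[OF x] by blast
  show ?thesis
  proof (cases "a = [] \<or> b = []")
    case True
    then show ?thesis using ab sub by auto
  next
    case False
    then obtain a' l h b' where a: "a = a' @ [l]" and b: "b = h # b'"
      by (metis rev_exhaust list.exhaust)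
    let ?h = "hd p" and ?l = "last p"
    have wa: "gwalk (metric_graph N d) a" and wb: "gwalk (metric_graph N d) b"
      and e: "{l, x} \<in> gedges (metric_graph N d)" "{x, h} \<in> gedges (metric_graph N d)"
      using w False by (auto simp: ab gwalk_def successively_append_iff successively_Cons a b)
    have N: "l \<in> N" "x \<in> N" "h \<in> N" "d l x = 1" "d x h = 1" "?h \<in> N" "?l \<in> N"
      using metric_graph_edge_nodes[OF e(1)] metric_graph_edge_nodes[OF e(2)] sub
        hd_in_set[of p] last_in_set[of p] ab by auto
    have "l \<noteq> h" using dis ab a b by auto
    then have "d l h \<noteq> 0" using zero_iff N by auto
    moreover have "even (d l h)" using parity[of l x h] N by auto
    ultimately have lh: "d l h \<ge> 2" by presburger
    have 1: "d ?h l < d ?h x + d x l"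
      using walk_avoiding_node[OF wa N(2)] dis ab a by (cases a') auto
    have 2: "d h ?l < d h x + d x ?l"
      using walk_avoiding_node[OF wb N(2)] dis ab b by auto
    have "\<not> d ?h ?l < d ?h x + d x ?l"
    proof
      assume lt: "d ?h ?l < d ?h x + d x ?l"
      have "d l ?l < d l x + d x ?l"
        using four_point[of l ?l ?h x] 1 lt N sym[of l ?h] sym[of x l] sym[of ?l x] sym[of ?l ?h]
        by auto
      then have "d l h < d l x + d x h"
        using four_point[of l h ?l x] 2 N sym[of h x] sym[of x ?l] by auto
      then show False using lh N by auto
    qed
    then show ?thesis using triangle[of ?h ?l x] N by auto
  qed
qed

end

section \<open>Diameter and center of a spanned subtree\<close>

locale spanned_tree = tree_metric +
  fixes X x1 x2 D
  assumes X: "X \<subseteq> N" and x12: "x1 \<in> X" "x2 \<in> X" "d x1 x2 = D"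
    and diam: "\<And>x y. \<lbrakk>x \<in> X; y \<in> X\<rbrakk> \<Longrightarrow> d x y \<le> D"
begin

abbreviation "S \<equiv> spanned_subtree (metric_graph N d) X"

lemma X_ne: "X \<noteq> {}" using x12 by auto

sublocale H: tree_metric "span_nodes X" d
  using tree_metric_span_nodes X X_ne by blast

lemma S_eq: "S = metric_graph (span_nodes X) d"
  using spanned_subtree_metric_graph X X_ne by blast

lemma gverts_S: "gverts S = span_nodes X"
  unfolding S_eq by (simp add: metric_graph_def)

lemma gdist_S: "\<lbrakk>x \<in> span_nodes X; y \<in> span_nodes X\<rbrakk> \<Longrightarrow> gdist S x y = d x y"
  using H.gdist_metric_graph S_eq by simp

lemma HN: "z \<in> span_nodes X \<Longrightarrow> z \<in> N"
  using span_nodes_subset_nodes X by blast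

lemma XH: "x \<in> X \<Longrightarrow> x \<in> span_nodes X"
  using span_nodes_superset by blast

lemma ecc_image: "v \<in> span_nodes X \<Longrightarrow> gecc S v = Max (d v ` span_nodes X)"
  using gdist_S by (simp add: gecc_def gverts_S)

lemma dist_le_ecc: "\<lbrakk>v \<in> span_nodes X; z \<in> span_nodes X\<rbrakk> \<Longrightarrow> d v z \<le> gecc S v"
  using H.finite_nodes by (simp add: ecc_image)

lemma ecc_eqI:
  assumes "v \<in> span_nodes X" "\<And>x. x \<in> X \<Longrightarrow> d v x \<le> r" "y \<in> X" "d v y = r"
  shows "gecc S v = r"
  unfolding ecc_image[OF assms(1)]
proof (rule Max_eqI)
  show "r \<in> d v ` span_nodes X" using assms XH by force
qed (use H.finite_nodes span_nodes_in_ball[of v X r] assms HN X in auto)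

text \<open>Balls are used twice: around each \<open>x \<in> X\<close> to bound
  \<open>d v x\<close>, then around \<open>v\<close> itself. So no distance in the span exceeds
  those within \<open>X\<close>.\<close>

lemma ecc_le_diam:
  assumes "v \<in> span_nodes X"
  shows "gecc S v \<le> D"
proof -
  have "d v x \<le> D" if "x \<in> X" for x
    using span_nodes_in_ball[of x X D v] diam that assms HN X sym[of v x] by auto
  then have "d v z \<le> D" if "z \<in> span_nodes X" for z
    using span_nodes_in_ball[of v X D z] assms HN X that by auto
  then show ?thesis using H.finite_nodes assms by (simp add: ecc_image H.nodes_nonempty)
qed

lemma gdiam_S: "gdiam S = D"
  unfolding gdiam_def
proof (rule Max_eqI)
  have "gecc S x1 = D" using ecc_eqI[of x1 D x2] x12 XH diam by auto
  then show "D \<in> gecc S ` gverts S" using x12 XH gverts_S by force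
qed (use H.finite_nodes ecc_le_diam gverts_S in auto)

text \<open>By parity every neighbour of \<open>v\<close> in the span is strictly nearer to
  \<open>y\<close>; for two of them, \<open>u\<close> and \<open>w\<close>, this violates the
  four-point condition for \<open>u, w, v, y\<close>.\<close>

lemma gleaf_S:
  assumes "v \<in> X" "y \<in> X" "d v y = D"
  shows "gleaf S v"
proof -
  have vH: "v \<in> span_nodes X" using assms XH by blast
  have "card {u \<in> span_nodes X. d v u = 1} \<le> 1"
  proof (rule ccontr)
    assume "\<not> ?thesis"
    then obtain u w where uw: "u \<in> span_nodes X" "w \<in> span_nodes X" "d v u = 1" "d v w = 1" "u \<noteq> w"
      using H.finite_nodes card_le_Suc0_iff_eq[of "{u \<in> span_nodes X. d v u = 1}"] by auto
    have "d u y \<le> D" "d w y \<le> D"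
      using dist_le_ecc[of u y] dist_le_ecc[of w y] ecc_le_diam uw XH assms(2) by force+
    moreover have "d u w \<noteq> 0" using zero_iff uw HN by auto
    moreover have "even (d u v + d v w + d u w)" using parity uw HN vH by blast
    moreover have "d u v = 1" using sym uw HN vH by metis
    ultimately have "d u w \<ge> 2" using uw by presburger
    moreover have "d u y < D + 1" "d w y < D + 1" using \<open>d u y \<le> D\<close> \<open>d w y \<le> D\<close> by auto
    moreover have "odd (D + d u y)" "odd (D + d w y)"
      using parity[of v u y] parity[of v w y] uw assms HN X by auto
    then have "d u y \<noteq> D" "d w y \<noteq> D" by auto
    moreover have "u \<in> N" "w \<in> N" "v \<in> N" "y \<in> N" using uw HN assms X vH by auto
    ultimately show False
      using four_point[of u w v y] \<open>d u v = 1\<close> uw(3,4) assms(3) sym[of v w] by auto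
  qed
  then show ?thesis
    using vH H.gdegree_metric_graph[OF vH] gverts_S S_eq by (auto simp: gleaf_def)
qed

lemma mid_in_span_nodes:
  assumes "c \<in> N" "d x1 c + d c x2 = D"
  shows "c \<in> span_nodes X"
  using convex_nodesD[OF convex_span_nodes[OF X], of x1 x2 c] assms x12 XH[OF x12(1)] XH[OF x12(2)]
  by simp

text \<open>The four-point condition for \<open>c\<close>, \<open>x\<close> and the diametral pair.
  As \<open>r\<close> bounds the larger half, the two central nodes of an odd diameter are covered
  too.\<close>

lemma mid_dist:
  assumes "c \<in> N" "d x1 c + d c x2 = D" "x \<in> X" "d x1 c \<le> r" "d c x2 \<le> r"
  shows "d c x \<le> r"
proof -
  have N: "x1 \<in> N" "x2 \<in> N" "x \<in> N" using x12 X assms by auto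
  then show ?thesis
    using four_point[of c x x1 x2] assms diam[of x1 x] diam[of x x2] x12 sym[of c x1] sym[of x1 x]
    by auto
qed

lemma ecc_lower:
  assumes "z \<in> span_nodes X"
  shows "D \<le> d z x1 + d z x2" "d z x1 \<le> gecc S z" "d z x2 \<le> gecc S z"
proof -
  have "z \<in> N" "x1 \<in> N" "x2 \<in> N" using assms HN x12 X by auto
  then show "D \<le> d z x1 + d z x2" using triangle[of x1 x2 z] sym[of z x1] x12 by simp
qed (use assms dist_le_ecc XH x12 in blast)+

lemma gcenter_even:
  assumes c: "c \<in> N" "d x1 c = r" "d c x2 = r" and D: "D = 2 * r"
  shows "gcenter S = {c}"
proof -
  have cH: "c \<in> span_nodes X" using mid_in_span_nodes c D by auto
  have "gecc S c = r" using ecc_eqI[OF cH, of r x2] mid_dist[of c] c D x12 by auto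
  moreover have "z = c" if z: "z \<in> span_nodes X" "gecc S z \<le> r" for z
  proof -
    have "d z c + d x1 x2 \<le> d z x1 + d c x2 \<or> d z c + d x1 x2 \<le> d z x2 + d c x1"
      using four_point[of z c x1 x2] z c HN X x12 by auto
    then have "d z c = 0" using ecc_lower[OF z(1)] z c D x12 X sym[of c x1] by auto
    then show ?thesis using zero_iff z c HN by auto
  qed
  ultimately have "gcenter S \<subseteq> {c}" using cH unfolding gcenter_def gverts_S by fastforce
  moreover have "r \<le> gecc S z" if "z \<in> span_nodes X" for z
    using ecc_lower[OF that] D by auto
  then have "c \<in> gcenter S" using cH \<open>gecc S c = r\<close> unfolding gcenter_def gverts_S by simp
  ultimately show ?thesis by blast
qed

lemma gcenter_odd:
  assumes c: "c1 \<in> N" "c2 \<in> N" "d x1 c1 = r" "d c1 c2 = 1" "d c2 x2 = r" and D: "D = Suc (2 * r)"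
  shows "gcenter S = {c1, c2}"
proof -
  have N: "x1 \<in> N" "x2 \<in> N" using x12 X by auto
  have d1: "d c1 x2 = Suc r" and d2: "d x1 c2 = Suc r"
    using triangle[of x1 x2 c1] triangle[of c1 x2 c2] triangle[of x1 x2 c2] triangle[of x1 c2 c1]
      c N D x12 by auto
  have cH: "c1 \<in> span_nodes X" "c2 \<in> span_nodes X" using mid_in_span_nodes[of c1] mid_in_span_nodes[of c2] c D d1 d2 by auto
  have e: "gecc S c1 = Suc r" "gecc S c2 = Suc r"
    using ecc_eqI[OF cH(1), of "Suc r" x2] ecc_eqI[OF cH(2), of "Suc r" x1] sym[of c2 x1]
      mid_dist[of c1 _ "Suc r"] mid_dist[of c2 _ "Suc r"] c D x12 d1 d2 N by auto
  moreover have "z = c1 \<or> z = c2" if z: "z \<in> span_nodes X" "gecc S z \<le> Suc r" for z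
  proof -
    have zN: "z \<in> N" using z HN by auto
    \<comment> \<open>The two distances add up to \<open>D\<close> or \<open>D + 1\<close>, and
      parity excludes the latter; so \<open>z\<close> lies on the path from \<open>x1\<close> to
      \<open>x2\<close>.\<close>
    have "even (d z x1 + D + d z x2)" using parity[of z x1 x2] zN N x12 by auto
    then have s: "d z x1 + d z x2 = D"
      using ecc_lower[OF z(1)] z D by presburger
    have "d z x1 = r \<and> d z x2 = Suc r \<or> d z x1 = Suc r \<and> d z x2 = r"
      using s ecc_lower[OF z(1)] z D by linarith
    then have "d z c1 = 0 \<or> d z c2 = 0"
      using four_point[of z c1 x1 x2] four_point[of z c2 x1 x2] zN N c d1 d2 D x12
        sym[of c1 x1] sym[of c2 x1] by auto
    then show ?thesis using zero_iff zN c by auto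
  qed
  ultimately have "gcenter S \<subseteq> {c1, c2}" using cH unfolding gcenter_def gverts_S by fastforce
  moreover have "Suc r \<le> gecc S z" if "z \<in> span_nodes X" for z
    using ecc_lower[OF that] D by auto
  then have "c1 \<in> gcenter S" "c2 \<in> gcenter S"
    using cH e unfolding gcenter_def gverts_S by simp_all
  ultimately show ?thesis by blast
qed

end

section \<open>Reattaching a vertex\<close>

text \<open>Vertices of \<open>G\<close> must keep their names in a root, so a copy of a tree moves
  only its other nodes. The infinite type supplies the new names.\<close>

lemma fresh_renaming:
  fixes N :: "'a::infinite set"
  assumes "finite N" "finite B" "S \<subseteq> N"
  shows "\<exists>f. inj_on f N \<and> (\<forall>x\<in>S. f x = x) \<and> f ` (N - S) \<inter> (N \<union> B) = {}"
proof -
  have "infinite (- (N \<union> B))" using assms infinite_UNIV by (simp add: Compl_eq_Diff_UNIV)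
  then obtain F where F: "finite F" "card F = card (N - S)" "F \<subseteq> - (N \<union> B)"
    using infinite_arbitrarily_large by metis
  then obtain g where g: "bij_betw g (N - S) F"
    using finite_same_card_bij[of "N - S" F] assms by auto
  then have "g x \<notin> N \<union> B" if "x \<in> N - S" for x using that F by (auto simp: bij_betw_def)
  then show ?thesis
    using g by (intro exI[of _ "\<lambda>x. if x \<in> S then x else g x"])
      (fastforce simp: bij_betw_def inj_on_def)
qed

text \<open>A pendant path of length \<open>k\<close> at \<open>c\<close>. A connection of length
  \<open>l\<close> uses it with \<open>l = Suc k\<close>, as joining the two trees adds the last
  edge.\<close>

lemma extend_at_node:
  fixes N :: "'a::infinite set"
  assumes "tree_metric N d" "c \<in> N"
  shows "\<exists>N' d' c'. tree_metric N' d' \<and> N \<subseteq> N' \<and> c' \<in> N' \<and>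
    (\<forall>x\<in>N. \<forall>y\<in>N. d' x y = d x y) \<and> (\<forall>y\<in>N. d' c' y = k + d c y)"
proof (induction k)
  case 0
  then show ?case using assms by (intro exI[of _ N] exI[of _ d] exI[of _ c]) auto
next
  case (Suc k)
  then obtain N' d' c' where t: "tree_metric N' d'" "N \<subseteq> N'" "c' \<in> N'"
    "\<forall>x\<in>N. \<forall>y\<in>N. d' x y = d x y" "\<forall>y\<in>N. d' c' y = k + d c y" by blast
  interpret E: tree_metric N' d' by fact
  obtain z where z: "z \<notin> N'" using ex_new_if_finite[OF infinite_UNIV E.finite_nodes] by blast
  define D where "D = join_metric N' d' c' (\<lambda>_ _. 0) z"
  have "tree_metric (N' \<union> {z}) D"
    unfolding D_def using tree_metric_join[OF t(1) tree_metric_singleton] z t by auto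
  moreover have "\<forall>x\<in>N. \<forall>y\<in>N. D x y = d x y"
    using t by (auto simp: D_def join_metric_def subset_iff)
  moreover have "\<forall>y\<in>N. D z y = Suc k + d c y"
  proof
    fix y assume y: "y \<in> N"
    then have "y \<in> N'" using t(2) by blast
    then have "D z y = Suc (d' c' y)"
      using z E.sym[of y c'] t(3) by (simp add: D_def join_metric_def)
    then show "D z y = Suc k + d c y" using t(5) y by simp
  qed
  ultimately show ?case using t(2)
    by (intro exI[of _ "N' \<union> {z}"] exI[of _ D] exI[of _ z]) auto
qed

text \<open>
  The tree is doubled: the first copy carries the nodes \<open>C\<close>, the second one the remaining nodes
  of \<open>V\<close>, and the node \<open>v\<close> of the second copy is joined to the node \<open>c\<close> of the first one by a
  path of length \<open>l\<close>.
\<close>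

lemma reattach_metric:
  fixes N :: "'a::infinite set"
  assumes t: "tree_metric N d" and V: "V \<subseteq> N" "C \<subseteq> V" "v \<in> V - C" and c: "c \<in> N" and l: "l > 0"
  shows "\<exists>N' d'. tree_metric N' d' \<and> V \<subseteq> N' \<and>
    (\<forall>x\<in>C. \<forall>y\<in>C. d' x y = d x y) \<and> (\<forall>x\<in>V-C. \<forall>y\<in>V-C. d' x y = d x y) \<and>
    (\<forall>x\<in>V-C. \<forall>y\<in>C. d' x y = d x v + l + d c y)"
proof -
  interpret tree_metric N d by fact
  obtain k where k: "l = Suc k" using l gr0_implies_Suc by blast
  obtain N1 d1 c' where e: "tree_metric N1 d1" "N \<subseteq> N1" "c' \<in> N1"
    "\<forall>x\<in>N. \<forall>y\<in>N. d1 x y = d x y" "\<forall>y\<in>N. d1 c' y = k + d c y"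
    using extend_at_node[OF t c] by blast
  interpret E: tree_metric N1 d1 by fact
  have VN1: "V \<subseteq> N1" using V e by auto
  have CN1: "C \<subseteq> N1" using V(2) VN1 by (rule subset_trans)
  \<comment> \<open>In the first copy the nodes outside \<open>C\<close> give up their names, so
    that the vertices of \<open>V - C\<close> can keep theirs in the second copy.\<close>
  from fresh_renaming[OF E.finite_nodes E.finite_nodes CN1]
  obtain f where f: "inj_on f N1" "\<forall>x\<in>C. f x = x" "f ` (N1 - C) \<inter> (N1 \<union> N1) = {}"
    by (elim exE conjE)
  have VCN: "V - C \<subseteq> N" using V(1) by blast
  from fresh_renaming[OF finite_nodes finite_imageI[OF E.finite_nodes, of f] VCN]
  obtain g where g: "inj_on g N" "\<forall>x\<in>V-C. g x = x" "g ` (N - (V - C)) \<inter> (N \<union> f ` N1) = {}"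
    by (elim exE conjE)
  let ?f = "\<lambda>x y. d1 (inv_into N1 f x) (inv_into N1 f y)"
  let ?g = "\<lambda>x y. d (inv_into N g x) (inv_into N g y)"
  have fC: "inv_into N1 f y = y" "y \<in> f ` N1" if "y \<in> C" for y
  proof -
    have "y \<in> N1" "f y = y" using that V VN1 f by auto
    then show "inv_into N1 f y = y" "y \<in> f ` N1"
      using inv_into_f_f[OF f(1), of y] image_eqI[of y f y N1] by auto
  qed
  have gC: "inv_into N g x = x" "x \<in> g ` N" if "x \<in> V - C" for x
  proof -
    have "x \<in> N" "g x = x" using that V g by auto
    then show "inv_into N g x = x" "x \<in> g ` N"
      using inv_into_f_f[OF g(1), of x] image_eqI[of x g x N] by auto
  qed
  have nf: "x \<notin> f ` N1" if "x \<in> V - C" for x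
  proof
    assume "x \<in> f ` N1"
    then obtain y where y: "y \<in> N1" "x = f y" by auto
    then have "y \<in> N1 - C" using f(2) that by auto
    then have "x \<in> f ` (N1 - C)" using y by auto
    moreover have "x \<in> N1" using that VN1 by auto
    ultimately show False using f(3) by auto
  qed
  have disj: "f ` N1 \<inter> g ` N = {}"
  proof -
    have ng: "g x \<notin> f ` N1" if "x \<in> N" for x
    proof (cases "x \<in> V - C")
      case True
      then show ?thesis using nf g(2) by auto
    next
      case False
      then have "g x \<in> g ` (N - (V - C))" using that by blast
      then show ?thesis using g(3) by blast
    qed
    show ?thesis
    proof (rule equals0I)
      fix y assume "y \<in> f ` N1 \<inter> g ` N"
      then obtain x where "x \<in> N" "y = g x" "y \<in> f ` N1" by blast
      then show False using ng[of x] by simp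
    qed
  qed
  define D where "D = join_metric (f ` N1) ?f (f c') ?g (g v)"
  have "tree_metric (f ` N1 \<union> g ` N) D"
    unfolding D_def
    by (rule tree_metric_join[OF E.tree_metric_image[OF f(1)] tree_metric_image[OF g(1)] disj])
      (use e(3) V in auto)
  moreover have "V \<subseteq> f ` N1 \<union> g ` N" using fC gC by blast
  moreover have "D x y = d x y" if "x \<in> C" "y \<in> C" for x y
  proof -
    have "D x y = d1 x y" using that fC by (simp add: D_def join_metric_def)
    moreover have "x \<in> N" "y \<in> N" using that V by auto
    ultimately show ?thesis using e(4) by simp
  qed
  moreover have "D x y = d x y" if "x \<in> V - C" "y \<in> V - C" for x y
    using that nf gC by (simp add: D_def join_metric_def)
  moreover have "D x y = d x v + l + d c y" if x: "x \<in> V - C" and y: "y \<in> C" for x y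
  proof -
    have N: "x \<in> N" "v \<in> N" "y \<in> N" "y \<in> N1" using x y V VN1 by auto
    have "inv_into N1 f (f c') = c'" "inv_into N g (g v) = v"
      using inv_into_f_f[OF f(1) e(3)] inv_into_f_f[OF g(1) N(2)] by auto
    then have "D x y = Suc (d1 y c' + d v x)"
      using nf[OF x] fC[OF y] gC[OF x] by (simp add: D_def join_metric_def)
    moreover have "d1 y c' = k + d c y" using E.sym[OF N(4) e(3)] e(5) N by simp
    ultimately show ?thesis using sym[of x v] N k by simp
  qed
  ultimately show ?thesis by blast
qed

section \<open>Roots and the order in which they are compared\<close>

definition root_metric :: "'a ugraph \<Rightarrow> 'a set \<Rightarrow> ('a \<Rightarrow> 'a \<Rightarrow> nat) \<Rightarrow> bool" where
  "root_metric G N d \<longleftrightarrow> tree_metric N d \<and> gverts G \<subseteq> N \<and>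
     (\<forall>u\<in>gverts G. \<forall>v\<in>gverts G. u \<noteq> v \<longrightarrow> ({u, v} \<in> gedges G \<longleftrightarrow> d u v \<le> 4))"

text \<open>Ordered pairs are counted, whence the factor 2 wherever the pairs of a single vertex are
  split off.\<close>

definition dist_count :: "'a set \<Rightarrow> ('a \<Rightarrow> 'a \<Rightarrow> nat) \<Rightarrow> nat \<Rightarrow> nat" where
  "dist_count V d k = card {(x, y) \<in> V \<times> V. d x y = k}"

text \<open>The subtraction is truncated, so Steiner leaves cost no more than Steiner nodes of
  degree two.\<close>

definition steiner_excess :: "'a ugraph \<Rightarrow> 'a set \<Rightarrow> ('a \<Rightarrow> 'a \<Rightarrow> nat) \<Rightarrow> nat" where
  "steiner_excess G N d = (\<Sum>x \<in> N - gverts G. card {u \<in> N. d x u = 1} - 2)"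

text \<open>A well-founded order can only minimise, so the counts to be maximised are subtracted
  from an upper bound.\<close>

definition root_order ::
    "'a ugraph \<Rightarrow> (('a set \<times> ('a \<Rightarrow> 'a \<Rightarrow> nat)) \<times> ('a set \<times> ('a \<Rightarrow> 'a \<Rightarrow> nat))) set" where
  "root_order G = measures
    [\<lambda>(N, d). dist_count (gverts G) d 1,
     \<lambda>(N, d). card (gverts G \<times> gverts G) - dist_count (gverts G) d 4,
     \<lambda>(N, d). card (gverts G \<times> gverts G) - dist_count (gverts G) d 2,
     \<lambda>(N, d). steiner_excess G N d]"

lemma dist_count_le: "finite V \<Longrightarrow> dist_count V d k \<le> card (V \<times> V)"
  unfolding dist_count_def by (rule card_mono) auto

text \<open>Separates off the pairs between \<open>v\<close> and \<open>A\<close>. With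
  \<open>A\<close> the neighbours of \<open>v\<close> on one side, a reattachment leaves the
  remaining pairs at distance at most four unchanged.\<close>

lemma dist_count_split:
  fixes V :: "'a set"
  assumes "finite V" "v \<in> V" "A \<subseteq> V - {v}" "\<And>x y. \<lbrakk>x \<in> V; y \<in> V\<rbrakk> \<Longrightarrow> d x y = d y x"
  shows "dist_count V d k =
    card ({(x, y) \<in> V \<times> V. d x y = k} - ({v} \<times> A \<union> A \<times> {v})) + 2 * card {y \<in> A. d v y = k}"
proof -
  let ?P = "{(x, y) \<in> V \<times> V. d x y = k}" and ?Z = "{v} \<times> A \<union> A \<times> {v}"
  let ?Y = "{y \<in> A. d v y = k}"
  have finP: "finite ?P" 
    using finite_cartesian_product[OF assms(1) assms(1)] by (rule finite_subset[rotated]) auto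
  have finY: "finite ?Y" 
    using assms(1,3) finite_subset[of A V] by (intro finite_subset[of ?Y A]) auto
  have dv: "d x v = d v x" if "x \<in> A" for x using assms that by blast
  have "?P \<inter> ?Z = {v} \<times> ?Y \<union> ?Y \<times> {v}"
  proof (intro set_eqI)
    fix p :: "'a \<times> 'a"
    obtain x y :: 'a where p: "p = (x, y)" by fastforce
    show "p \<in> ?P \<inter> ?Z \<longleftrightarrow> p \<in> {v} \<times> ?Y \<union> ?Y \<times> {v}"
      unfolding p using dv assms(2,3) by auto
  qed
  moreover have "({v} \<times> ?Y) \<inter> (?Y \<times> {v}) = {}" using assms(3) by auto
  ultimately have "card (?P \<inter> ?Z) = card ({v} \<times> ?Y) + card (?Y \<times> {v})"
    using card_Un_disjoint[of "{v} \<times> ?Y" "?Y \<times> {v}"] finY by simp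
  then have "card (?P \<inter> ?Z) = 2 * card ?Y" using finY by (simp add: card_cartesian_product)
  moreover have "card ?P = card (?P - ?Z) + card (?P \<inter> ?Z)"
    using card_Diff_subset_Int[of ?P ?Z] card_mono[OF finP, of "?P \<inter> ?Z"] finP
    by (simp add: card_Diff_subset_Int)
  ultimately show ?thesis by (simp add: dist_count_def)
qed

section \<open>Separating vertices and their sides\<close>

locale optimal_root =
  fixes G :: "'a::infinite ugraph" and N :: "'a set" and d :: "'a \<Rightarrow> 'a \<Rightarrow> nat"
  assumes root: "root_metric G N d"
    and optimal: "\<And>N' d'. root_metric G N' d' \<Longrightarrow> ((N', d'), (N, d)) \<notin> root_order G"
begin

abbreviation "V \<equiv> gverts G"

sublocale tree_metric N d
  using root by (simp add: root_metric_def)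

lemma VN: "V \<subseteq> N" and V_nodes: "\<And>x. x \<in> V \<Longrightarrow> x \<in> N"
  using root by (auto simp: root_metric_def)

lemma finite_V: "finite V"
  using VN finite_nodes finite_subset by blast

lemma edge_iff: "\<lbrakk>u \<in> V; w \<in> V; u \<noteq> w\<rbrakk> \<Longrightarrow> {u, w} \<in> gedges G \<longleftrightarrow> d u w \<le> 4"
  using root by (simp add: root_metric_def)

lemma root_metricI:
  assumes "tree_metric N' d'" "V \<subseteq> N'"
    and "\<And>u w. \<lbrakk>u \<in> V; w \<in> V; u \<noteq> w\<rbrakk> \<Longrightarrow> d' u w \<le> 4 \<longleftrightarrow> d u w \<le> 4"
  shows "root_metric G N' d'"
  using assms edge_iff by (simp add: root_metric_def)

text \<open>For a clique \<open>X\<close> this is the union of all cliques containing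
  \<open>X\<close>; in particular it contains \<open>X\<close> itself.\<close>

definition common_nbrs :: "'a set \<Rightarrow> 'a set" where
  "common_nbrs X = {a \<in> V. \<forall>x\<in>X. d a x \<le> 4}"

text \<open>The form in which freeness enters the metric argument: among the neighbours of
  \<open>v\<close>, those compatible with \<open>X\<close> are closed under adjacency.
  \<open>side_closed\<close> turns this local condition into one about components of
  \<open>G - v\<close>.\<close>

definition separates :: "'a \<Rightarrow> 'a set \<Rightarrow> bool" where
  "separates v X \<longleftrightarrow> v \<in> X \<and> X \<noteq> {v} \<and> X \<subseteq> V \<and> (\<forall>x\<in>X. \<forall>y\<in>X. d x y \<le> 4) \<and>
     (\<forall>a\<in>common_nbrs X. \<forall>u\<in>V. a \<noteq> v \<longrightarrow> u \<noteq> v \<longrightarrow> d u v \<le> 4 \<longrightarrow> d u a \<le> 4 \<longrightarrow> u \<in> common_nbrs X)"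

definition nbrs :: "'a \<Rightarrow> 'a set \<Rightarrow> 'a set" where
  "nbrs v X = common_nbrs X - {v}"

text \<open>The union of the components of \<open>G - v\<close> that contain a vertex of \<open>nbrs v X\<close>.\<close>

definition side :: "'a \<Rightarrow> 'a set \<Rightarrow> 'a set" where
  "side v X = {y \<in> V. \<exists>a\<in>nbrs v X. d a y < d v y}"

context
  fixes v X
  assumes sep: "separates v X"
begin

lemma sep_v: "v \<in> X" "v \<in> V" "v \<in> N"
  using sep V_nodes by (auto simp: separates_def)

lemma sep_X: "X \<subseteq> V" "x \<in> X \<Longrightarrow> x \<in> N" "\<lbrakk>x \<in> X; y \<in> X\<rbrakk> \<Longrightarrow> d x y \<le> 4"
  using sep V_nodes by (auto simp: separates_def)

lemma X_nbrs: "X - {v} \<subseteq> nbrs v X" "X - {v} \<noteq> {}"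
  using sep by (auto simp: separates_def nbrs_def common_nbrs_def)

lemma nbrs_V: "a \<in> nbrs v X \<Longrightarrow> a \<in> V" and nbrs_N: "a \<in> nbrs v X \<Longrightarrow> a \<in> N"
  using V_nodes by (auto simp: nbrs_def common_nbrs_def)

lemma nbrs_X: "\<lbrakk>a \<in> nbrs v X; x \<in> X\<rbrakk> \<Longrightarrow> d a x \<le> 4"
  by (auto simp: nbrs_def common_nbrs_def)

lemma nbrs_ne: "a \<in> nbrs v X \<Longrightarrow> a \<noteq> v"
  by (auto simp: nbrs_def)

lemma nbrs_v: "a \<in> nbrs v X \<Longrightarrow> d v a \<le> 4" "a \<in> nbrs v X \<Longrightarrow> d v a > 0"
  using nbrs_X[of a v] sep_v sym[of a v] nbrs_N[of a] nbrs_ne[of a] zero_iff[of v a] by auto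

lemma star:
  assumes "a \<in> nbrs v X" "u \<in> V" "u \<noteq> v" "d u v \<le> 4" "d u a \<le> 4"
  shows "u \<in> nbrs v X"
  using sep assms unfolding separates_def nbrs_def by auto

lemma v_not_side: "v \<notin> side v X"
  using sep_v by (auto simp: side_def)

lemma side_V: "side v X \<subseteq> V - {v}"
  using v_not_side by (auto simp: side_def)

lemma nbrs_side: "nbrs v X \<subseteq> side v X"
  using nbrs_v nbrs_N nbrs_V by (force simp: side_def)

lemma side_nbrs:
  assumes "y \<in> side v X" "d v y \<le> 4"
  shows "y \<in> nbrs v X"
proof -
  obtain a where a: "a \<in> nbrs v X" "d a y < d v y" "y \<in> V" using assms by (auto simp: side_def)
  moreover have "y \<noteq> v" using assms v_not_side by auto
  ultimately show ?thesis
    using star[of a y] assms sym[of y v] sym[of y a] V_nodes sep_v nbrs_N by auto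
qed

text \<open>If \<open>y\<close> is far from \<open>v\<close>, the four-point condition for
  \<open>a, z, v, y\<close> shows that the witness \<open>a\<close> of \<open>y\<close> is also near
  enough to \<open>z\<close>. If \<open>y\<close> is near \<open>v\<close>, it belongs to
  \<open>nbrs v X\<close> itself and is the witness for a far \<open>z\<close>. Whenever
  \<open>z\<close> is near \<open>v\<close>, \<open>star\<close> applies. Tree powers thus behave
  like chordal graphs: a separation among the neighbours of \<open>v\<close> extends to
  \<open>G - v\<close>.\<close>

lemma side_closed:
  assumes y: "y \<in> side v X" and z: "z \<in> V" "z \<noteq> v" and yz: "d y z \<le> 4"
  shows "z \<in> side v X"
proof -
  obtain a where a: "a \<in> nbrs v X" "d a y < d v y" and yV: "y \<in> V"
    using y by (auto simp: side_def)
  have N: "y \<in> N" "z \<in> N" "a \<in> N" "v \<in> N" using yV z a V_nodes nbrs_N sep_v by auto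
  have av: "d a v \<le> 4" using nbrs_v[OF a(1)] sym N by simp
  have fp: "d a z + d v y \<le> d a y + d v z \<or> d a z + d v y \<le> d a v + d y z"
    using four_point[of a z v y] sym[of z y] sym[of z v] N by auto
  show ?thesis
  proof (cases "d v z \<le> 4")
    case vz: True
    have "z \<in> nbrs v X"
    proof (cases "d v y \<le> 4")
      case True
      then show ?thesis
        using star[OF side_nbrs[OF y], of z] z vz yz sym[of z v] sym[of z y] N by auto
    next
      case False
      then have "d a z \<le> 4" using fp a av vz yz by linarith
      then show ?thesis using star[OF a(1), of z] z vz sym[of z v] sym[of z a] N by auto
    qed
    then show ?thesis using nbrs_side by blast
  next
    case vz: False
    show ?thesis
    proof (cases "d v y \<le> 4")
      case True
      then show ?thesis
        using side_nbrs[OF y] yz vz z by (auto simp: side_def intro!: bexI[of _ y])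
    next
      case False
      then have "d a z < d v z" using fp a av vz yz by linarith
      then show ?thesis using a z by (auto simp: side_def)
    qed
  qed
qed

text \<open>The hypotheses \<open>near\<close>, \<open>far\<close> and \<open>cross\<close> ensure
  that no adjacency across the cut appears or disappears. Apart from the pairs of \<open>v\<close>
  with \<open>nbrs v X\<close>, all pairs across the cut have distance above four before and after,
  so these pairs alone change the counts.\<close>

lemma reattach_root:
  assumes c: "c \<in> N" and l: "l > 0"
    and near: "\<And>a. a \<in> nbrs v X \<Longrightarrow> l + d c a \<le> 4"
    and far: "\<And>y. \<lbrakk>y \<in> side v X; y \<notin> nbrs v X\<rbrakk> \<Longrightarrow> 4 < l + d c y"
    and cross: "\<And>x y. \<lbrakk>x \<in> V; x \<notin> side v X; x \<noteq> v; y \<in> side v X\<rbrakk> \<Longrightarrow> 4 < d x v + l + d c y"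
  shows "\<exists>N' d'. root_metric G N' d' \<and>
    (\<forall>k\<le>4. dist_count V d' k + 2 * card {y \<in> nbrs v X. d v y = k} =
       dist_count V d k + 2 * card {y \<in> nbrs v X. l + d c y = k})"
proof -
  let ?C = "side v X"
  have vC: "v \<in> V - ?C" "?C \<subseteq> V" using sep_v v_not_side side_V by auto
  obtain N' d' where t: "tree_metric N' d'" "V \<subseteq> N'"
    and d1: "\<And>x y. \<lbrakk>x \<in> ?C; y \<in> ?C\<rbrakk> \<Longrightarrow> d' x y = d x y"
    and d2: "\<And>x y. \<lbrakk>x \<in> V - ?C; y \<in> V - ?C\<rbrakk> \<Longrightarrow> d' x y = d x y"
    and d3: "\<And>x y. \<lbrakk>x \<in> V - ?C; y \<in> ?C\<rbrakk> \<Longrightarrow> d' x y = d x v + l + d c y"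
    using reattach_metric[OF tree_metric_axioms VN vC(2,1) c l] by blast
  interpret T: tree_metric N' d' by fact
  have sym': "d' x y = d' y x" if "x \<in> V" "y \<in> V" for x y
    using T.sym t(2) that by blast
  have dv: "d' v y = l + d c y" if "y \<in> ?C" for y
    using d3[of v y] vC that sep_v by simp
  have mixed: "4 < d' x y \<and> 4 < d x y"
    if "x \<in> V - ?C" "y \<in> ?C" "\<not> (x = v \<and> y \<in> nbrs v X)" for x y
  proof (cases "x = v")
    case True
    then show ?thesis using that dv far[of y] side_nbrs[of y] by fastforce
  next
    case False
    then have "4 < d' x y" using that d3[of x y] cross[of x y] by auto
    moreover have "\<not> d y x \<le> 4" using side_closed[of y x] that False by blast
    ultimately show ?thesis using sym[of x y] V_nodes that vC by auto
  qed
  have nb: "d' v y \<le> 4 \<and> d v y \<le> 4" if "y \<in> nbrs v X" for y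
    using dv[of y] near[OF that] nbrs_v that nbrs_side by auto
  have same: "d' x y = k \<longleftrightarrow> d x y = k"
    if "x \<in> V" "y \<in> V" "\<not> (x = v \<and> y \<in> nbrs v X)" "\<not> (y = v \<and> x \<in> nbrs v X)" "k \<le> 4" for x y k
  proof -
    consider "x \<in> ?C" "y \<in> ?C" | "x \<in> V - ?C" "y \<in> V - ?C" | "x \<in> V - ?C" "y \<in> ?C"
      | "x \<in> ?C" "y \<in> V - ?C" using \<open>x \<in> V\<close> \<open>y \<in> V\<close> by blast
    then show ?thesis
    proof cases
      case 3
      then show ?thesis using mixed[of x y] that by auto
    next
      case 4
      then show ?thesis
        using mixed[of y x] that sym'[of x y] sym[of x y] V_nodes by auto
    qed (use d1 d2 in auto)
  qed
  have "d' u w \<le> 4 \<longleftrightarrow> d u w \<le> 4" if uw: "u \<in> V" "w \<in> V" for u w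
  proof -
    consider "u = v" "w \<in> nbrs v X" | "w = v" "u \<in> nbrs v X"
      | "\<not> (u = v \<and> w \<in> nbrs v X)" "\<not> (w = v \<and> u \<in> nbrs v X)" by blast
    then show ?thesis
    proof cases
      case 1
      then show ?thesis using nb by simp
    next
      case 2
      then show ?thesis using nb[of u] sym'[of u v] sym[of u v] V_nodes uw by auto
    next
      case 3
      then show ?thesis using same[OF uw 3, of "d' u w"] same[OF uw 3, of "d u w"] by auto
    qed
  qed
  then have "root_metric G N' d'" using root_metricI t by blast
  moreover have "dist_count V d' k + 2 * card {y \<in> nbrs v X. d v y = k} =
       dist_count V d k + 2 * card {y \<in> nbrs v X. l + d c y = k}" if k: "k \<le> 4" for k
  proof -
    let ?Z = "{v} \<times> nbrs v X \<union> nbrs v X \<times> {v}"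
    have A: "nbrs v X \<subseteq> V - {v}" using nbrs_V nbrs_ne by blast
    have "{y \<in> nbrs v X. d' v y = k} = {y \<in> nbrs v X. l + d c y = k}"
      using dv nbrs_side by (metis (no_types, lifting) Collect_cong subsetD)
    then have "dist_count V d' k = card ({(x, y) \<in> V \<times> V. d' x y = k} - ?Z) +
        2 * card {y \<in> nbrs v X. l + d c y = k}"
      using dist_count_split[OF finite_V sep_v(2) A, of d' k] sym' by simp
    moreover have "dist_count V d k = card ({(x, y) \<in> V \<times> V. d x y = k} - ?Z) +
        2 * card {y \<in> nbrs v X. d v y = k}"
      using dist_count_split[OF finite_V sep_v(2) A, of d k] sym V_nodes by simp
    moreover have "{(x, y) \<in> V \<times> V. d' x y = k} - ?Z = {(x, y) \<in> V \<times> V. d x y = k} - ?Z"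
      using same k by fastforce
    ultimately show ?thesis by simp
  qed
  ultimately show ?thesis by blast
qed

text \<open>The counts of all other pairs cancel in \<open>reattach_root\<close>, so optimality
  compares the distances from \<open>v\<close> alone; a later criterion speaks only when the earlier
  ones tie.\<close>

lemma reattach_optimal:
  assumes "c \<in> N" "l > 0"
    and "\<And>a. a \<in> nbrs v X \<Longrightarrow> l + d c a \<le> 4"
    and "\<And>y. \<lbrakk>y \<in> side v X; y \<notin> nbrs v X\<rbrakk> \<Longrightarrow> 4 < l + d c y"
    and "\<And>x y. \<lbrakk>x \<in> V; x \<notin> side v X; x \<noteq> v; y \<in> side v X\<rbrakk> \<Longrightarrow> 4 < d x v + l + d c y"
  defines "old \<equiv> \<lambda>k. card {y \<in> nbrs v X. d v y = k}"
    and "new \<equiv> \<lambda>k. card {y \<in> nbrs v X. l + d c y = k}"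
  shows "old 1 \<le> new 1" "old 1 = new 1 \<Longrightarrow> new 4 \<le> old 4"
    "\<lbrakk>old 1 = new 1; old 4 = new 4\<rbrakk> \<Longrightarrow> new 2 \<le> old 2"
proof -
  obtain N' d' where r: "root_metric G N' d'" and
    cnt: "\<And>k. k \<le> 4 \<Longrightarrow> dist_count V d' k + 2 * old k = dist_count V d k + 2 * new k"
    using reattach_root[OF assms(1-5)] unfolding old_def new_def by blast
  let ?n = "card (V \<times> V)"
  have no: "((N', d'), (N, d)) \<notin> root_order G" using optimal r by blast
  then have 1: "dist_count V d 1 \<le> dist_count V d' 1"
    and m4: "dist_count V d' 1 = dist_count V d 1 \<Longrightarrow>
      ?n - dist_count V d 4 \<le> ?n - dist_count V d' 4"
    and m2: "\<lbrakk>dist_count V d' 1 = dist_count V d 1; dist_count V d' 4 = dist_count V d 4\<rbrakk> \<Longrightarrow>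
      ?n - dist_count V d 2 \<le> ?n - dist_count V d' 2"
    by (simp_all add: root_order_def not_less)
  \<comment> \<open>These bounds undo the truncated subtractions in
    \<open>root_order\<close>.\<close>
  have le: "dist_count V d' k \<le> ?n" "dist_count V d k \<le> ?n" for k
    using dist_count_le[OF finite_V] by blast+
  have 4: "dist_count V d' 4 \<le> dist_count V d 4" if "dist_count V d' 1 = dist_count V d 1"
    using m4[OF that] le[of 4] by linarith
  have 2: "dist_count V d' 2 \<le> dist_count V d 2"
    if "dist_count V d' 1 = dist_count V d 1" "dist_count V d' 4 = dist_count V d 4"
    using m2[OF that] le[of 2] by linarith
  show "old 1 \<le> new 1" using 1 cnt[of 1] by simp
  show "new 4 \<le> old 4" if "old 1 = new 1" using 4 cnt[of 1] cnt[of 4] that by simp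
  show "new 2 \<le> old 2" if "old 1 = new 1" "old 4 = new 4"
    using 2 cnt[of 1] cnt[of 4] cnt[of 2] that by simp
qed

end

end

section \<open>Optimal roots\<close>

context optimal_root
begin

lemma common_nbrs_V: "a \<in> common_nbrs X \<Longrightarrow> a \<in> V"
  by (simp add: common_nbrs_def)

lemma finite_common_nbrs: "finite (common_nbrs X)"
  using finite_V finite_subset[of "common_nbrs X" V] common_nbrs_V by blast

section \<open>Pushing a separating vertex away\<close>

context
  fixes v X
  assumes sep: "separates v X"
begin

lemma finite_nbrs: "finite (nbrs v X)"
  using finite_common_nbrs by (simp add: nbrs_def)

text \<open>
  A reattachment that decreases no distance from \<open>v\<close> always yields a root, hence by optimality
  it cannot improve the first two criteria.
\<close>

lemma push_optimal:
  assumes c: "c \<in> N" and l: "l > 0" "d v c \<le> l"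
    and near: "\<And>a. a \<in> nbrs v X \<Longrightarrow> l + d c a \<le> 4"
  shows "\<lbrakk>a \<in> nbrs v X; d v a = 1\<rbrakk> \<Longrightarrow> l + d c a = 1"
    and "\<lbrakk>a \<in> nbrs v X; l + d c a = 4\<rbrakk> \<Longrightarrow> d v a = 4"
proof -
  note N = sep_v(3)[OF sep] nbrs_N[OF sep] V_nodes
  have mono: "d v y \<le> l + d c y" if "y \<in> N" for y
    using triangle[of v y c] c l N that by fastforce
  have far: "4 < l + d c y" if "y \<in> side v X" "y \<notin> nbrs v X" for y
    using side_nbrs[OF sep that(1)] that mono[of y] side_V[OF sep] N by fastforce
  have cross: "4 < d x v + l + d c y"
    if x: "x \<in> V" "x \<notin> side v X" "x \<noteq> v" and y: "y \<in> side v X" for x y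
  proof -
    have yN: "y \<in> N" using y side_V[OF sep] V_nodes by blast
    have "\<not> d y x \<le> 4" using side_closed[OF sep y] x by blast
    then have "4 < d x y" using sym[of x y] x N yN by simp
    also have "d x y \<le> d x v + d v y" using triangle x N yN by blast
    also have "\<dots> \<le> d x v + l + d c y" using mono[OF yN] by simp
    finally show ?thesis .
  qed
  let ?O = "\<lambda>k. {y \<in> nbrs v X. d v y = k}" and ?M = "\<lambda>k. {y \<in> nbrs v X. l + d c y = k}"
  note opt = reattach_optimal[OF sep c l(1) near far cross]
  have fin: "finite (?O k)" "finite (?M k)" for k using finite_nbrs by auto
  \<comment> \<open>As no distance from \<open>v\<close> drops, new pairs at distance one are old
    ones, and old pairs at distance four persist. Optimality forbids that either inclusion be
    strict.\<close>
  have sub1: "?M 1 \<subseteq> ?O 1"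
  proof
    fix y assume y: "y \<in> ?M 1"
    then have "d v y \<le> 1" "d v y > 0" using mono[of y] N nbrs_v(2)[OF sep, of y] by auto
    then show "y \<in> ?O 1" using y by auto
  qed
  have sub4: "?O 4 \<subseteq> ?M 4"
  proof
    fix y assume y: "y \<in> ?O 4"
    then have "4 \<le> l + d c y" "l + d c y \<le> 4" using mono[of y] N near[of y] by auto
    then show "y \<in> ?M 4" using y by auto
  qed
  have eq1: "?M 1 = ?O 1" using card_seteq[OF fin(1) sub1] opt(1) by blast
  have eq4: "?O 4 = ?M 4" using card_seteq[OF fin(2) sub4] opt(2) eq1 by simp
  show "l + d c a = 1" if "a \<in> nbrs v X" "d v a = 1" using eq1 that by blast
  show "d v a = 4" if "a \<in> nbrs v X" "l + d c a = 4" using eq4 that by blast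
qed

text \<open>Otherwise insert a path of length \<open>4 - d v a\<close> between \<open>v\<close> and
  its side, where \<open>a\<close> is a farthest neighbour there; that is, reattach at
  \<open>c = v\<close>. All neighbours stay within four and \<open>a\<close> reaches it, so the
  number of pairs at distance four grows.\<close>

lemma far_nbr: "\<exists>a\<in>nbrs v X. d v a = 4"
proof (rule ccontr)
  assume no: "\<not> ?thesis"
  let ?m = "Max (d v ` nbrs v X)"
  have f: "finite (d v ` nbrs v X)" "d v ` nbrs v X \<noteq> {}"
    using finite_nbrs X_nbrs[OF sep] by auto
  obtain a where a: "a \<in> nbrs v X" "d v a = ?m" using Max_in[OF f] by auto
  have le: "d v y \<le> d v a" if "y \<in> nbrs v X" for y using Max_ge[OF f(1)] a that by auto
  have "d v a < 4" using a no nbrs_v(1)[OF sep a(1)] by force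
  then have "d v a = 4"
    using push_optimal(2)[of v "4 - d v a" a] a le sep_v[OF sep] by fastforce
  then show False using no a by blast
qed

text \<open>A neighbour \<open>a\<close> with \<open>d v a = 4\<close> is within four of
  \<open>x1\<close> and \<open>x2\<close>. If both of these were nearer to \<open>v\<close> than
  \<open>d x1 x2\<close>, the four-point condition for \<open>a, v, x1, x2\<close> would
  fail.\<close>

lemma separator_eccentric:
  assumes x: "x1 \<in> X" "x2 \<in> X"
  shows "\<exists>y\<in>X. d x1 x2 \<le> d v y"
proof (rule ccontr)
  assume no: "\<not> ?thesis"
  obtain a where a: "a \<in> nbrs v X" "d v a = 4" using far_nbr by blast
  have N: "a \<in> N" "v \<in> N" "x1 \<in> N" "x2 \<in> N"
    using a nbrs_N[OF sep] sep_v[OF sep] sep_X[OF sep] x by auto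
  have "d a x1 \<le> 4" "d a x2 \<le> 4" using nbrs_X[OF sep a(1)] x by auto
  moreover have "d v x1 < d x1 x2" "d v x2 < d x1 x2" using no x by auto
  ultimately show False using four_point[of a v x1 x2] a sym[of a v] N by auto
qed

end

section \<open>Clique-intersections of diameter four\<close>

lemma common_nbrs_ball:
  assumes X: "X \<subseteq> V" and x: "x1 \<in> X" "x2 \<in> X" "d x1 x2 = 4"
    and c: "c \<in> N" "d x1 c = 2" "d c x2 = 2" and a: "a \<in> common_nbrs X"
  shows "d c a \<le> 2"
proof -
  have N: "a \<in> N" "x1 \<in> N" "x2 \<in> N" using a x X V_nodes common_nbrs_V by auto
  have "d a x1 \<le> 4" "d a x2 \<le> 4" using a x by (auto simp: common_nbrs_def)
  then show ?thesis using four_point[of c a x1 x2] x c sym[of c x1] N by auto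
qed

text \<open>The closure property of clique-intersections: a maximal clique containing
  \<open>X\<close> consists of common neighbours of \<open>X\<close>, so it contains every vertex
  compatible with all of these.\<close>

definition saturated :: "'a set \<Rightarrow> bool" where
  "saturated X \<longleftrightarrow> (\<forall>u\<in>V. (\<forall>a\<in>common_nbrs X. d u a \<le> 4) \<longrightarrow> u \<in> X)"

text \<open>Common neighbours of \<open>X\<close> lie within two of the center \<open>c\<close>. A
  vertex in that ball is therefore compatible with all of them and belongs to the saturated
  \<open>X\<close>; so \<open>X\<close> consists of exactly the real nodes of the ball.\<close>

lemma saturated_diam4:
  assumes X: "X \<subseteq> common_nbrs X" "saturated X"
    and x: "x1 \<in> X" "x2 \<in> X" "d x1 x2 = 4" and c: "c \<in> N" "d x1 c = 2" "d c x2 = 2"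
  shows "common_nbrs X = X" and "\<lbrakk>u \<in> V; d c u \<le> 2\<rbrakk> \<Longrightarrow> u \<in> X"
proof -
  have XV: "X \<subseteq> V" using X common_nbrs_V by blast
  note ball = common_nbrs_ball[OF XV x c]
  show *: "u \<in> X" if u: "u \<in> V" "d c u \<le> 2" for u
  proof -
    have "d u a \<le> 4" if a: "a \<in> common_nbrs X" for a
      using triangle[of u a c] sym[of u c] ball[OF a] u c V_nodes common_nbrs_V[OF a] by simp
    then show ?thesis using X(2) u by (simp add: saturated_def)
  qed
  have "a \<in> X" if "a \<in> common_nbrs X" for a
    using * ball[OF that] common_nbrs_V[OF that] by blast
  then show "common_nbrs X = X" using X(1) by blast
qed

context
  fixes v X x1 x2 c
  assumes sep: "separates v X" and sat: "saturated X"
    and x: "x1 \<in> X" "x2 \<in> X" "d x1 x2 = 4" and c: "c \<in> N" "d x1 c = 2" "d c x2 = 2"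
begin

lemma X_common: "X \<subseteq> common_nbrs X"
  using sep_X[OF sep] unfolding common_nbrs_def by blast

lemma nbrs_diam4: "nbrs v X = X - {v}"
  unfolding nbrs_def saturated_diam4(1)[OF X_common sat x c] ..

lemma ball_diam4: "\<lbrakk>u \<in> V; d c u \<le> 2\<rbrakk> \<Longrightarrow> u \<in> X"
  by (rule saturated_diam4(2)[OF X_common sat x c])

lemma X_ball: "y \<in> X \<Longrightarrow> d c y \<le> 2"
  using common_nbrs_ball[OF sep_X(1)[OF sep] x c] X_common by blast

lemma far_end: "\<exists>z\<in>X. z \<noteq> v \<and> d c z = 2"
proof (cases "v = x1")
  case True
  then have "x2 \<noteq> v" using x sep_X(2)[OF sep] by auto
  then show ?thesis using x c by blast
next
  case False
  moreover have "d c x1 = 2" using x c sym[of c x1] sep_X(2)[OF sep] by simp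
  ultimately show ?thesis using x by (intro bexI[of _ x1]) auto
qed

text \<open>Reattach \<open>v\<close> at \<open>c\<close> by a path of length two. Since this cannot
  be an improvement, no vertex of \<open>X\<close> is at distance one from \<open>v\<close>, and
  those at distance two from \<open>c\<close> are already at distance four from \<open>v\<close>.
  Parity settles the rest.\<close>

lemma diam4_dist:
  assumes y: "y \<in> X" "y \<noteq> v"
  shows "d v y = 2 + d c y"
proof -
  note vN = sep_v(3)[OF sep] and XN = sep_X(2)[OF sep]
  have vc: "d v c \<le> 2" using X_ball[OF sep_v(1)[OF sep]] sym vN c by simp
  have near: "2 + d c a \<le> 4" if "a \<in> nbrs v X" for a using X_ball that nbrs_diam4 by auto
  have push: "d v a \<noteq> 1" "d c a = 2 \<Longrightarrow> d v a = 4" if "a \<in> nbrs v X" for a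
    using push_optimal[OF sep c(1) _ vc, of a] near that by auto
  have yA: "y \<in> nbrs v X" using y nbrs_diam4 by simp
  have le: "d v y \<le> 2 + d c y" using triangle[of v y c] vN XN y c vc by fastforce
  have y2: "d c y \<le> 2" using X_ball y by blast
  have "d v y \<noteq> 1" using push(1)[OF yA] .
  moreover have "d v y \<noteq> 0" using zero_iff vN XN y by auto
  moreover have "d c y = 2 \<Longrightarrow> d v y = 4" using push(2)[OF yA] .
  \<comment> \<open>A vertex \<open>z\<close> at distance two from \<open>c\<close> is at distance
    four from \<open>v\<close>, so \<open>d v c\<close> is even, and \<open>d v y\<close> has the
    parity of \<open>d c y\<close>.\<close>
  moreover have "even (d v y + d c y)"
  proof -
    obtain z where z: "z \<in> X" "z \<noteq> v" "d c z = 2" using far_end by blast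
    then have "d v z = 4" using push(2)[of z] nbrs_diam4 by simp
    then have "even (d v c)" using parity[of v z c] z sym[of z c] vN XN c by simp
    then show ?thesis using parity[of v y c] sym[of y c] vN XN y c by simp
  qed
  ultimately show ?thesis using le y2 by presburger
qed

lemma diam4_center_dist: "d v c = 2"
proof -
  note vN = sep_v(3)[OF sep] and XN = sep_X(2)[OF sep]
  obtain z where z: "z \<in> X" "z \<noteq> v" "d c z = 2" using far_end by blast
  then have "d v z = 4" using diam4_dist by simp
  then show ?thesis
    using triangle[of v z c] X_ball[OF sep_v(1)[OF sep]] sym[of v c] vN XN z c by simp
qed

section \<open>The middle node between a separating vertex and the center\<close>

context
  fixes s
  assumes s: "s \<in> N" "d v s = 1" "d s c = 1"
begin

text \<open>A real \<open>s\<close> would be near \<open>c\<close> and hence in \<open>X\<close>,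
  and \<open>diam4_dist\<close> would put it at distance three from \<open>v\<close>.\<close>

lemma mid_steiner: "s \<notin> V"
proof
  assume sV: "s \<in> V"
  have "s \<in> X" using ball_diam4[OF sV] s sym[of s c] c by simp
  moreover have "s \<noteq> v" using s sep_v[OF sep] by auto
  ultimately show False using diam4_dist s sym[of s c] c by auto
qed

text \<open>\<open>near_s\<close> and \<open>near_c\<close> are the two components left when the
  edge \<open>sc\<close> is deleted.\<close>

definition near_s :: "'a set" where "near_s = {x \<in> N. d x s < d x c}"
definition near_c :: "'a set" where "near_c = {x \<in> N. \<not> d x s < d x c}"

lemma near_sD: "x \<in> near_s \<Longrightarrow> x \<in> N" "x \<in> near_s \<Longrightarrow> d x c = Suc (d x s)"
  using triangle[of x c s] s c by (auto simp: near_s_def)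

lemma near_cD: "x \<in> near_c \<Longrightarrow> x \<in> N" "x \<in> near_c \<Longrightarrow> d x s = Suc (d x c)"
proof -
  assume x: "x \<in> near_c"
  then show "x \<in> N" by (simp add: near_c_def)
  then have "d x s \<le> Suc (d x c)" "even (d x s + 1 + d x c)"
    using triangle[of x s c] parity[of x s c] s c sym[of c s] by auto
  moreover have "d x c \<le> d x s" using x by (auto simp: near_c_def)
  ultimately show "d x s = Suc (d x c)" by presburger
qed

lemma split_nodes: "near_s \<union> near_c = N" "near_s \<inter> near_c = {}"
  by (auto simp: near_s_def near_c_def)

lemma split_dist:
  assumes "x \<in> near_s" "y \<in> near_c"
  shows "d x y = d x s + 1 + d c y"
proof -
  note N = near_sD[OF assms(1)] near_cD[OF assms(2)]
  have "d x y \<le> d x s + 1 + d c y"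
    using triangle[of x y s] triangle[of s y c] s c N by auto
  moreover have "d x s + 1 + d c y \<le> d x y"
    using four_point[of x c s y] N s c sym[of s y] sym[of c y] sym[of c s] by auto
  ultimately show ?thesis by simp
qed

lemma tree_metric_near_s: "tree_metric near_s d"
proof (rule tree_metric_convex)
  show "near_s \<noteq> {}" using s c by (auto simp: near_s_def intro!: exI[of _ s])
  fix x y z assume a: "x \<in> near_s" "y \<in> near_s" "z \<in> N" "d x z + d z y = d x y"
  show "z \<in> near_s"
  proof (rule ccontr)
    assume "z \<notin> near_s"
    then have z: "z \<in> near_c" using split_nodes a by blast
    have "d x y \<le> d x s + d y s"
      using triangle[of x y s] sym[of y s] near_sD a s by fastforce
    then show False
      using split_dist[OF a(1) z] split_dist[OF a(2) z] a sym[of z y] near_sD[OF a(2)] by simp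
  qed
qed (use near_sD in blast)

lemma tree_metric_near_c: "tree_metric near_c d"
proof (rule tree_metric_convex)
  show "near_c \<noteq> {}" using s c by (auto simp: near_c_def intro!: exI[of _ c])
  fix x y z assume a: "x \<in> near_c" "y \<in> near_c" "z \<in> N" "d x z + d z y = d x y"
  show "z \<in> near_c"
  proof (rule ccontr)
    assume "z \<notin> near_c"
    then have z: "z \<in> near_s" using split_nodes a by blast
    have N: "x \<in> N" "y \<in> N" using a near_cD by auto
    have "d x y \<le> d c x + d c y" using triangle[of x y c] sym[of x c] N c by auto
    then show False
      using split_dist[OF z a(1)] split_dist[OF z a(2)] a sym[of z x] N by simp
  qed
qed (use near_cD in blast)

lemma v_near_s: "v \<in> near_s" and c_near_c: "c \<in> near_c" and s_near_s: "s \<in> near_s"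
  using s c sep_v[OF sep] diam4_center_dist sym[of c s] by (auto simp: near_s_def near_c_def)

text \<open>\<open>x\<close> is not in \<open>X\<close>: \<open>diam4_dist\<close> would place it
  farther from \<open>v\<close> than the way over \<open>s\<close> allows. So \<open>x\<close> is at
  distance at least two from \<open>s\<close>, which forces \<open>y\<close> within one of
  \<open>c\<close> and hence into \<open>X\<close>. But then \<open>x\<close> is adjacent to both
  \<open>v\<close> and \<open>y\<close>, and \<open>star\<close> puts it into \<open>X\<close> after
  all.\<close>

lemma no_crossing_edge:
  assumes x: "x \<in> near_s" "x \<in> V" "x \<noteq> v" and y: "y \<in> near_c" "y \<in> V"
  shows "4 < d x y"
proof (rule ccontr)
  assume "\<not> ?thesis"
  then have xy: "d x y \<le> 4" by simp
  have N: "x \<in> N" "y \<in> N" "v \<in> N" using x y V_nodes sep_v[OF sep] by auto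
  have dxy: "d x y = d x s + 1 + d c y" using split_dist x y by blast
  have xc: "d c x = Suc (d x s)" using near_sD(2)[OF x(1)] sym[of c x] N c by simp
  have vx: "d v x \<le> 1 + d x s" using triangle[of v x s] s N sym[of x s] by simp
  have xX: "x \<notin> X" using diam4_dist[of x] vx xc x by auto
  then have "\<not> d c x \<le> 2" using ball_diam4 x by blast
  then have "2 \<le> d x s" using xc by simp
  then have "d c y \<le> 1" using dxy xy by simp
  then have "y \<in> X" using ball_diam4 y by simp
  moreover have "y \<noteq> v" using y(1) v_near_s split_nodes by blast
  ultimately have yA: "y \<in> nbrs v X" using nbrs_diam4 by simp
  have "d x v \<le> 4" using vx dxy xy sym[of x v] N by simp
  then have "x \<in> nbrs v X" using star[OF sep yA x(2,3)] xy by simp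
  then show False using xX nbrs_diam4 by simp
qed

text \<open>Otherwise cut the edge \<open>sc\<close> and join \<open>v\<close> to \<open>c\<close>
  by a new Steiner node \<open>t\<close>; \<open>s\<close> stays attached to \<open>v\<close> with
  its remaining branches. Then \<open>s\<close> loses a neighbour, \<open>c\<close> exchanges
  \<open>s\<close> for \<open>t\<close>, and \<open>t\<close> has degree two. Only the real node
  \<open>v\<close> gains degree, which \<open>steiner_excess\<close> ignores.\<close>

lemma mid_degree: "card {u \<in> N. d s u = 1} = 2"
proof (rule ccontr)
  assume deg: "card {u \<in> N. d s u = 1} \<noteq> 2"
  have vN: "v \<in> N" using sep_v[OF sep] by simp
  have "{v, c} \<subseteq> {u \<in> N. d s u = 1}" using s c vN sym[of s v] by auto
  moreover have "v \<noteq> c" using v_near_s c_near_c split_nodes by blast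
  ultimately have "2 \<le> card {u \<in> N. d s u = 1}"
    using card_mono[of "{u \<in> N. d s u = 1}" "{v, c}"] finite_nodes by simp
  \<comment> \<open>Because of truncated subtraction, losing a neighbour lowers the excess only from
    degree three on.\<close>
  then have deg3: "3 \<le> card {u \<in> N. d s u = 1}" using deg by linarith
  obtain t where t: "t \<notin> N" using ex_new_if_finite[OF infinite_UNIV finite_nodes] by blast
  define d1 where "d1 = join_metric near_c d c (\<lambda>_ _. 0) t"
  define D where "D = join_metric near_s d v d1 t"
  have tn: "t \<notin> near_c" "t \<notin> near_s" using t near_cD near_sD by blast+
  have m1: "tree_metric (near_c \<union> {t}) d1"
    unfolding d1_def by (rule tree_metric_join[OF tree_metric_near_c tree_metric_singleton])
      (use tn c_near_c in auto)
  have "tree_metric (near_s \<union> (near_c \<union> {t})) D"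
    unfolding D_def by (rule tree_metric_join[OF tree_metric_near_s m1])
      (use tn v_near_s split_nodes in auto)
  moreover have un: "near_s \<union> (near_c \<union> {t}) = insert t N" using split_nodes by blast
  ultimately have tm: "tree_metric (insert t N) D" by simp
  interpret T: tree_metric "insert t N" D by fact
  have nc: "x \<notin> near_s" if "x \<in> near_c" for x using that split_nodes by blast
  have Dss: "D x y = d x y" if "x \<in> near_s" "y \<in> near_s" for x y
    using that by (simp add: D_def join_metric_def)
  have Dcc: "D x y = d x y" if "x \<in> near_c" "y \<in> near_c" for x y
    using that nc tn by (simp add: D_def d1_def join_metric_def)
  have d1t: "d1 t y = Suc (d c y)" if "y \<in> near_c" for y
    using that tn sym[of y c] near_cD c by (simp add: d1_def join_metric_def)
  have Dsc: "D x y = 2 + d x v + d c y" if "x \<in> near_s" "y \<in> near_c" for x y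
    using that nc tn d1t by (simp add: D_def join_metric_def)
  have Dst: "D x t = Suc (d x v)" if "x \<in> near_s" for x
    using that tn by (simp add: D_def d1_def join_metric_def)
  have Dtc: "D t y = Suc (d c y)" if "y \<in> near_c" for y
    using that tn nc d1t by (simp add: D_def join_metric_def)
  \<comment> \<open>From \<open>v\<close> the way over \<open>t\<close> is as long as the one over
    \<open>s\<close>. From any other vertex it is no shorter, and there the distance exceeded four
    already.\<close>
  have cross: "D x y = d x y \<or> 4 < D x y \<and> 4 < d x y"
    if x: "x \<in> near_s" "x \<in> V" and y: "y \<in> near_c" "y \<in> V" for x y
  proof (cases "x = v")
    case True
    then show ?thesis using Dsc[OF x(1) y(1)] split_dist[OF x(1) y(1)] s vN by simp
  next
    case False
    have "d x s \<le> d x v + 1" using triangle[of x s v] near_sD x vN s by simp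
    then show ?thesis
      using no_crossing_edge[OF x False y] Dsc[OF x(1) y(1)] split_dist[OF x(1) y(1)] by simp
  qed
  have dist: "D x y = d x y \<or> 4 < D x y \<and> 4 < d x y" if xy: "x \<in> V" "y \<in> V" for x y
  proof -
    have N: "x \<in> N" "y \<in> N" using xy V_nodes by auto
    consider "x \<in> near_s" "y \<in> near_s" | "x \<in> near_c" "y \<in> near_c" | "x \<in> near_s" "y \<in> near_c"
      | "x \<in> near_c" "y \<in> near_s" using N split_nodes by blast
    then show ?thesis
    proof cases
      case 4
      then show ?thesis using cross[of y x] xy sym[OF N] T.sym[of x y] N by auto
    qed (use Dss Dcc cross xy in auto)
  qed
  have "root_metric G (insert t N) D"
  proof (rule root_metricI[OF tm])
    fix u w assume "u \<in> V" "w \<in> V"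
    then show "D u w \<le> 4 \<longleftrightarrow> d u w \<le> 4" using dist[of u w] by auto
  qed (use VN in blast)
  then have not_less: "((insert t N, D), (N, d)) \<notin> root_order G" by (rule optimal)
  have "{(x, y) \<in> V \<times> V. D x y = k} = {(x, y) \<in> V \<times> V. d x y = k}" if "k \<le> 4" for k
    using dist that by fastforce
  then have cnt: "dist_count V D k = dist_count V d k" if "k \<le> 4" for k
    using that by (simp add: dist_count_def)
  let ?deg = "\<lambda>x. card {u \<in> N. d x u = 1}" and ?deg' = "\<lambda>x. card {u \<in> insert t N. D x u = 1}"
  have fin: "finite {u \<in> N. d x u = 1}" for x using finite_nodes by simp
  have degs: "{u \<in> insert t N. D x u = 1} \<subseteq> {u \<in> N. d x u = 1} \<inter> near_s"
    if x: "x \<in> near_s" "x \<noteq> v" for x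
  proof
    fix u assume u: "u \<in> {u \<in> insert t N. D x u = 1}"
    have "d x v \<noteq> 0" using zero_iff x near_sD vN by blast
    then have "u \<noteq> t" using u Dst[OF x(1)] by auto
    moreover have "u \<notin> near_c" using Dsc[OF x(1), of u] u by auto
    ultimately have "u \<in> near_s" using u split_nodes by blast
    then show "u \<in> {u \<in> N. d x u = 1} \<inter> near_s" using u Dss[OF x(1)] near_sD by auto
  qed
  have degc: "{u \<in> insert t N. D x u = 1} \<subseteq> {u \<in> N. d x u = 1} \<inter> near_c \<union> (if x = c then {t} else {})"
    if x: "x \<in> near_c" for x
  proof
    fix u assume u: "u \<in> {u \<in> insert t N. D x u = 1}"
    have xN: "x \<in> N" using x near_cD by blast
    have "u \<notin> near_s"
      using Dsc[of u x] u x T.sym[of u x] near_sD[of u] xN by auto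
    moreover have "x = c" if "u = t"
      using u that Dtc[OF x] T.sym[of t x] xN zero_iff[of c x] c by auto
    moreover have "d x u = 1" if "u \<in> near_c" using Dcc[OF x that] u by simp
    ultimately show "u \<in> {u \<in> N. d x u = 1} \<inter> near_c \<union> (if x = c then {t} else {})"
      using u split_nodes by auto
  qed
  have deg_le: "?deg' x \<le> ?deg x" if x: "x \<in> N - V" for x
  proof -
    consider "x \<in> near_s" "x \<noteq> v" | "x \<in> near_c" "x \<noteq> c" | "x = c"
      using x split_nodes sep_v(2)[OF sep] by blast
    then show ?thesis
    proof cases
      case 1
      then show ?thesis using degs by (intro card_mono fin) blast
    next
      case 2
      then show ?thesis using degc[of x] by (intro card_mono fin) auto
    next
      case 3
      have "{u \<in> insert t N. D c u = 1} \<subseteq> insert t ({u \<in> N. d c u = 1} - {s})"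
        using degc[OF c_near_c] nc s_near_s by auto
      then have "?deg' c \<le> card (insert t ({u \<in> N. d c u = 1} - {s}))"
        using fin by (intro card_mono) auto
      also have "\<dots> \<le> Suc (card ({u \<in> N. d c u = 1} - {s}))" using fin by (simp add: card_insert_le_m1 card_insert_if)
      also have "\<dots> = ?deg c"
        using s c sym[of c s] fin by (intro card_Suc_Diff1) auto
      finally show ?thesis using 3 by simp
    qed
  qed
  have "s \<noteq> v" using mid_steiner sep_v[OF sep] by blast
  then have "{u \<in> insert t N. D s u = 1} \<subset> {u \<in> N. d s u = 1}"
    using degs[OF s_near_s] c s c_near_c nc by blast
  then have deg_s: "?deg' s < ?deg s" using fin by (intro psubset_card_mono)
  have "{u \<in> insert t N. D t u = 1} \<subseteq> {v, c}"
  proof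
    fix u assume u: "u \<in> {u \<in> insert t N. D t u = 1}"
    then have "u \<noteq> t" by auto
    then have uN: "u \<in> N" using u by simp
    show "u \<in> {v, c}"
    proof (cases "u \<in> near_s")
      case True
      then show ?thesis using u Dst[of u] T.sym[of t u] uN zero_iff[OF uN vN] by simp
    next
      case False
      then have "u \<in> near_c" using uN split_nodes by blast
      then show ?thesis using u Dtc[of u] uN zero_iff[OF c(1) uN] by auto
    qed
  qed
  then have deg_t: "?deg' t \<le> 2"
    using card_mono[of "{v, c}" "{u \<in> insert t N. D t u = 1}"] card_insert_le_m1[of 2 "{c}" v] by simp
  have "insert t N - V = insert t (N - V)" using t V_nodes by blast
  then have "steiner_excess G (insert t N) D = (?deg' t - 2) + (\<Sum>x\<in>N - V. ?deg' x - 2)"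
    using t finite_nodes by (simp add: steiner_excess_def)
  also have "\<dots> = (\<Sum>x\<in>N - V. ?deg' x - 2)" using deg_t by simp
  also have "\<dots> < (\<Sum>x\<in>N - V. ?deg x - 2)"
  proof (rule sum_strict_mono_ex1)
    show "\<forall>x\<in>N - V. ?deg' x - 2 \<le> ?deg x - 2" using deg_le by (simp add: diff_le_mono)
    show "\<exists>x\<in>N - V. ?deg' x - 2 < ?deg x - 2"
      using deg_s deg3 mid_steiner s by (intro bexI[of _ s]) auto
  qed (use finite_nodes in simp)
  finally have "steiner_excess G (insert t N) D < steiner_excess G N d"
    by (simp add: steiner_excess_def)
  then show False using not_less cnt by (simp add: root_order_def)
qed

end

end

section \<open>Exchanging vertices between two center nodes\<close>

context
  fixes X v1 v2 w1 w2 c1 c2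
  assumes sep: "separates v1 X" "separates v2 X" "separates w1 X" "separates w2 X"
    and ne: "v1 \<noteq> v2" "w1 \<noteq> w2"
    and c: "c1 \<in> N" "c2 \<in> N" "d c1 c2 = 1"
    and v: "d v1 c1 = 1" "d v1 c2 = 2" "d v2 c1 = 1" "d v2 c2 = 2"
    and w: "d w1 c1 = 2" "d w1 c2 = 1" "d w2 c1 = 2" "d w2 c2 = 1"
    and near: "\<forall>x\<in>X. d c1 x \<le> 2" "\<forall>x\<in>X. d c2 x \<le> 2"
begin

lemma swap_nodes:
  shows "v1 \<in> X" "v2 \<in> X" "w1 \<in> X" "w2 \<in> X" "v1 \<in> N" "v2 \<in> N" "w1 \<in> N" "w2 \<in> N"
  using sep sep_v by blast+

lemma v1_w1: "d v1 w1 = 3"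
proof -
  have "d v1 w1 \<le> 3" using triangle[of v1 w1 c1] sym[of c1 w1] swap_nodes c v w by simp
  moreover have "3 \<le> d v1 w1"
    using four_point[of v1 c2 c1 w1] sym[of c1 w1] sym[of c2 w1] sym[of c2 c1] swap_nodes c v w by auto
  ultimately show ?thesis by simp
qed

lemma common_nbrs_near:
  assumes a: "a \<in> common_nbrs X"
  shows "d c1 a \<le> 3" "d c2 a \<le> 3"
proof -
  have N: "a \<in> N" using a common_nbrs_V V_nodes by blast
  have "d a v1 \<le> 4" "d a w1 \<le> 4" using a swap_nodes by (auto simp: common_nbrs_def)
  then show "d c1 a \<le> 3" "d c2 a \<le> 3"
    using four_point[of c1 a v1 w1] four_point[of c2 a v1 w1] N swap_nodes c v w v1_w1
      sym[of c1 v1] sym[of c1 w1] sym[of c2 v1] sym[of c2 w1] by auto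
qed

text \<open>By parity the alternative is \<open>d c1 y = d v1 y + 1\<close>. Then the four-point
  condition with \<open>w1\<close> gives \<open>d c1 y \<le> 2\<close>, so
  \<open>d v1 y = 1\<close>, and reattaching \<open>v1\<close> at \<open>c1\<close> by a single edge
  would remove a pair at distance one.\<close>

lemma nbrs_dist:
  assumes y: "y \<in> nbrs v1 X"
  shows "d v1 y = 1 + d c1 y"
proof -
  note N = swap_nodes(5-8) nbrs_N[OF sep(1) y]
  have yW: "y \<in> common_nbrs X" using y by (simp add: nbrs_def)
  have "1 + d c1 a \<le> 4" if "a \<in> nbrs v1 X" for a
    using common_nbrs_near(1)[of a] that by (simp add: nbrs_def)
  then have "1 + d c1 y = 1" if "d v1 y = 1"
    using push_optimal(1)[OF sep(1) c(1), of 1 y] v y that by simp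
  moreover have "d v1 y > 0" using nbrs_v[OF sep(1) y] by simp
  moreover have "d y w1 \<le> 4" "d v1 y \<le> 1 + d c1 y" "d c1 y \<le> 1 + d v1 y"
    using yW swap_nodes triangle[of v1 y c1] triangle[of c1 y v1] sym[of c1 v1] N c v
    by (auto simp: common_nbrs_def)
  moreover have "even (d v1 y + 1 + d c1 y)" using parity[of y v1 c1] sym[of y v1] sym[of y c1] v N c by simp
  moreover have "d c1 y + 3 \<le> 1 + d y w1 \<or> d c1 y + 3 \<le> 2 + d v1 y"
    using four_point[of c1 y v1 w1] sym[of c1 v1] sym[of c1 w1] sym[of y v1] N c v w v1_w1 by auto
  ultimately show ?thesis by presburger
qed

lemma center_common: "c1 \<in> V \<Longrightarrow> c1 \<in> common_nbrs X" "c2 \<in> V \<Longrightarrow> c2 \<in> common_nbrs X"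
  using near by (fastforce simp: common_nbrs_def)+

text \<open>Moves \<open>v1\<close> from \<open>c1\<close> to \<open>c2\<close>: its distance to
  \<open>y\<close> changes from \<open>1 + d c1 y\<close> to \<open>1 + d c2 y\<close>, so the
  criteria for distances 1, 4, 2 compare \<alpha> and \<beta> at 0, 3, 1. The last inequality is
  strict because \<alpha> counts \<open>v1\<close> itself at 1, while \<open>v1\<close> forms no
  pair with itself.\<close>

lemma swap_optimal:
  assumes real: "c2 \<in> V \<longrightarrow> c1 \<in> V"
  defines "\<alpha> \<equiv> \<lambda>j. card {y \<in> common_nbrs X. d c1 y = j}"
    and "\<beta> \<equiv> \<lambda>j. card {y \<in> common_nbrs X. d c2 y = j}"
  shows "\<alpha> 0 \<le> \<beta> 0" "\<alpha> 0 = \<beta> 0 \<Longrightarrow> \<beta> 3 \<le> \<alpha> 3"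
    "\<lbrakk>\<alpha> 0 = \<beta> 0; \<alpha> 3 = \<beta> 3\<rbrakk> \<Longrightarrow> \<beta> 1 < \<alpha> 1"
proof -
  note N = swap_nodes(5-8)
  have v1W: "v1 \<in> common_nbrs X" using swap_nodes sep_X[OF sep(1)] by (auto simp: common_nbrs_def)
  have near1: "1 + d c2 a \<le> 4" if "a \<in> nbrs v1 X" for a
    using common_nbrs_near(2)[of a] that by (simp add: nbrs_def)
  \<comment> \<open>The second vertex \<open>w2\<close> at \<open>c2\<close> is needed here: a
    \<open>y\<close> this close to \<open>c2\<close> is adjacent to \<open>w1\<close> and
    \<open>w2\<close>, and the separation at \<open>w1\<close> makes it a common neighbour.\<close>
  have far: "4 < 1 + d c2 y" if y: "y \<in> side v1 X" "y \<notin> nbrs v1 X" for y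
  proof (rule ccontr)
    assume "\<not> ?thesis"
    then have yc: "d c2 y \<le> 3" by simp
    have yV: "y \<in> V" "y \<noteq> v1" using y side_V[OF sep(1)] by auto
    then have yX: "y \<notin> X" using X_nbrs[OF sep(1)] y by blast
    then have "y \<noteq> w1" using swap_nodes by blast
    have "d y w1 \<le> 4" "d y w2 \<le> 4"
      using triangle[of y w1 c2] triangle[of y w2 c2] sym[of y c2] sym[of c2 w1] sym[of c2 w2]
        yc w N c V_nodes[OF yV(1)] by auto
    moreover have "w2 \<in> nbrs w1 X" using X_nbrs[OF sep(3)] swap_nodes ne by blast
    ultimately have "y \<in> nbrs w1 X" using star[OF sep(3) _ yV(1) \<open>y \<noteq> w1\<close>] by blast
    then show False using y yV by (simp add: nbrs_def)
  qed
  \<comment> \<open>Here the second vertex \<open>v2\<close> at \<open>c1\<close> is needed: it lies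
    on the side of \<open>v1\<close>, so an outside \<open>x\<close> is not adjacent to it and is at
    distance at least three from \<open>v1\<close>.\<close>
  have cross: "4 < d x v1 + 1 + d c2 y"
    if x: "x \<in> V" "x \<notin> side v1 X" "x \<noteq> v1" and y: "y \<in> side v1 X" for x y
  proof -
    have xN: "x \<in> N" using x V_nodes by blast
    have out: "4 < d x z" if "z \<in> X" "z \<noteq> v1" for z
    proof -
      have "z \<in> side v1 X" using that X_nbrs[OF sep(1)] nbrs_side[OF sep(1)] by blast
      then have "\<not> d z x \<le> 4" using side_closed[OF sep(1)] x by blast
      then show ?thesis using sym[of x z] xN sep_X[OF sep(1)] that by simp
    qed
    have "4 < d x v2" using out swap_nodes ne by blast
    moreover have "d v1 v2 \<le> 2" using triangle[of v1 v2 c1] sym[of c1 v2] N c v by simp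
    ultimately have xv: "3 \<le> d x v1" using triangle[of x v2 v1] xN N by simp
    show ?thesis
    proof (cases "d c2 y = 0")
      case False
      then show ?thesis using xv by simp
    next
      case True
      \<comment> \<open>Distance three falls one short when \<open>y\<close> is \<open>c2\<close>
        itself. Then \<open>real\<close> makes \<open>c1\<close> a vertex of the side, and not being
        adjacent to it keeps \<open>x\<close> one step farther away.\<close>
      have yV: "y \<in> V" using y side_V[OF sep(1)] by blast
      then have "y = c2" using True zero_iff c V_nodes by blast
      then have c1V: "c1 \<in> V" using real yV by blast
      then have "c1 \<in> nbrs v1 X" using center_common v c by (auto simp: nbrs_def)
      then have "c1 \<in> side v1 X" using nbrs_side[OF sep(1)] by blast
      then have "\<not> d c1 x \<le> 4" using side_closed[OF sep(1)] x by blast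
      then have "4 \<le> d x v1" using triangle[of x c1 v1] sym[of x c1] xN N c v by simp
      then show ?thesis by simp
    qed
  qed
  have old: "{y \<in> nbrs v1 X. d v1 y = k} = {y \<in> nbrs v1 X. d c1 y + 1 = k}" for k
    using nbrs_dist by auto
  have N1: "nbrs v1 X = common_nbrs X - {v1}" by (simp add: nbrs_def)
  have dv: "d c1 v1 = 1" "d c2 v1 = 2" using v sym[of c1 v1] sym[of c2 v1] c N by auto
  have eqs: "{y \<in> nbrs v1 X. d v1 y = 1} = {y \<in> common_nbrs X. d c1 y = 0}"
    "{y \<in> nbrs v1 X. 1 + d c2 y = 1} = {y \<in> common_nbrs X. d c2 y = 0}"
    "{y \<in> nbrs v1 X. d v1 y = 4} = {y \<in> common_nbrs X. d c1 y = 3}"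
    "{y \<in> nbrs v1 X. 1 + d c2 y = 4} = {y \<in> common_nbrs X. d c2 y = 3}"
    "{y \<in> nbrs v1 X. d v1 y = 2} = {y \<in> common_nbrs X. d c1 y = 1} - {v1}"
    "{y \<in> nbrs v1 X. 1 + d c2 y = 2} = {y \<in> common_nbrs X. d c2 y = 1}"
    unfolding old using dv by (auto simp: N1)
  have "v1 \<in> {y \<in> common_nbrs X. d c1 y = 1}" using v1W dv by simp
  then have "card ({y \<in> common_nbrs X. d c1 y = 1} - {v1}) < \<alpha> 1"
    using finite_common_nbrs unfolding \<alpha>_def by (intro card_Diff1_less) auto
  then show "\<alpha> 0 \<le> \<beta> 0" "\<alpha> 0 = \<beta> 0 \<Longrightarrow> \<beta> 3 \<le> \<alpha> 3"
    "\<lbrakk>\<alpha> 0 = \<beta> 0; \<alpha> 3 = \<beta> 3\<rbrakk> \<Longrightarrow> \<beta> 1 < \<alpha> 1"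
    using reattach_optimal[OF sep(1) c(2) zero_less_one near1 far cross]
    unfolding \<alpha>_def \<beta>_def eqs by auto
qed

end

text \<open>If the center nodes are both real or both Steiner, the exchange is possible in both
  directions and the two strict inequalities contradict each other. If only one is real, moving a
  vertex from it to the other already lowers the number of pairs at distance one.\<close>

lemma free_not_spread:
  assumes "separates v1 X" "separates v2 X" "separates w1 X" "separates w2 X"
    "v1 \<noteq> v2" "w1 \<noteq> w2" "c1 \<in> N" "c2 \<in> N" "d c1 c2 = 1"
    "d v1 c1 = 1" "d v1 c2 = 2" "d v2 c1 = 1" "d v2 c2 = 2"
    "d w1 c1 = 2" "d w1 c2 = 1" "d w2 c1 = 2" "d w2 c2 = 1"
    "\<forall>x\<in>X. d c1 x \<le> 2" "\<forall>x\<in>X. d c2 x \<le> 2"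
  shows False
proof -
  have c21: "d c2 c1 = 1" using sym assms(7-9) by simp
  note A = swap_optimal[OF assms]
  note B = swap_optimal[OF assms(3,4,1,2,6,5,8,7) c21 assms(15,14,17,16,11,10,13,12,19,18)]
  note C = center_common[OF assms]
  let ?C = "\<lambda>c. {y \<in> common_nbrs X. d c y = 0}"
  have in0: "card (?C c) > 0" if "c \<in> common_nbrs X" "c \<in> N" for c
    using that finite_common_nbrs by (subst card_gt_0_iff) auto
  have out0: "card (?C c) = 0" if "c \<notin> V" "c \<in> N" for c
  proof -
    have "?C c = {}" using that zero_iff[of c] common_nbrs_V V_nodes by blast
    then show ?thesis by (simp only: card.empty)
  qed
  show False
  proof (cases "c1 \<in> V \<longleftrightarrow> c2 \<in> V")
    case True
    then show ?thesis using A B by auto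
  next
    case False
    then show ?thesis
      using A(1) B(1) C in0[of c1] in0[of c2] out0[of c1] out0[of c2] assms(7,8) by fastforce
  qed
qed

end

section \<open>Free vertices\<close>

lemma maximal_clique_extends:
  assumes "finite (gverts G)" "clique G K"
  shows "\<exists>K'. maximal_clique G K' \<and> K \<subseteq> K'"
proof -
  have "finite {K'. clique G K' \<and> K \<subseteq> K'}"
    by (rule finite_subset[of _ "Pow (gverts G)"]) (use assms(1) in \<open>auto simp: clique_def\<close>)
  moreover have "K \<in> {K'. clique G K' \<and> K \<subseteq> K'}" using assms(2) by simp
  ultimately obtain K' where K': "clique G K'" "K \<subseteq> K'"
    and mx: "\<forall>L. clique G L \<and> K \<subseteq> L \<longrightarrow> K' \<subseteq> L \<longrightarrow> K' = L"
    using finite_has_maximal2[of "{K'. clique G K' \<and> K \<subseteq> K'}" K] by auto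
  then have "maximal_clique G K'" unfolding maximal_clique_def by blast
  then show ?thesis using K' by blast
qed

lemma clique_intersection_clique:
  assumes "clique_intersection G X"
  shows "clique G X" "X \<noteq> {}"
  using assms by (fastforce simp: clique_intersection_def maximal_clique_def clique_def)+

lemma maximal_clique_intersection:
  assumes "clique_intersection G X" "maximal_clique G K" "X \<inter> K \<noteq> {}"
  shows "clique_intersection G (X \<inter> K)"
proof -
  obtain F where "F \<noteq> {}" "\<forall>K\<in>F. maximal_clique G K" "X = \<Inter>F"
    using assms(1) by (auto simp: clique_intersection_def)
  then show ?thesis
    using assms unfolding clique_intersection_def
    by (intro conjI exI[of _ "insert K F"]) auto
qed

lemma maximal_clique_is_intersection:
  "maximal_clique G K \<Longrightarrow> K \<noteq> {} \<Longrightarrow> clique_intersection G K"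
  unfolding clique_intersection_def by (intro conjI exI[of _ "{K}"]) auto

text \<open>Both clauses of freeness are used: the first for \<open>X \<inter> K'\<close> gives
  \<open>X \<inter> K' = {v}\<close>, then the second applies with \<open>X1 = K\<close> and
  \<open>X2 = K'\<close>.\<close>

lemma free_vertex_cliques:
  assumes fin: "finite (gverts G)" and X: "clique_intersection G X" and free: "free_vertex G X v"
    and K: "maximal_clique G K" "X \<subseteq> K" and K': "maximal_clique G K'" "v \<in> K'" "\<not> X \<subseteq> K'"
  shows "K \<inter> K' = {v}"
proof -
  have v: "v \<in> X" and nc: "\<not> constrained_vertex G X v" using free by (auto simp: free_vertex_def)
  have "finite X" using clique_intersection_clique(1)[OF X] fin finite_subset by (auto simp: clique_def)
  then have finXK: "finite (X \<inter> K')" by simp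
  have "clique_intersection G (X \<inter> K')" using maximal_clique_intersection[OF X K'(1)] v K' by blast
  then have "\<not> 2 \<le> card (X \<inter> K')" using nc v K' unfolding constrained_vertex_def by blast
  then have "card (X \<inter> K') \<le> Suc 0" by simp
  then have XK: "X \<inter> K' = {v}" using card_le_Suc0_iff_eq[OF finXK] v K' by blast
  show ?thesis
  proof (cases "X = K")
    case True
    then show ?thesis using XK by simp
  next
    case False
    have "clique_intersection G K" "clique_intersection G K'"
      using maximal_clique_is_intersection K K' v by blast+
    then have "\<not> {v} \<subset> K \<inter> K'" using nc v False K XK unfolding constrained_vertex_def by blast
    then show ?thesis using v K K' by blast
  qed
qed

context optimal_root
begin

lemma clique_iff: "clique G K \<longleftrightarrow> K \<subseteq> V \<and> (\<forall>x\<in>K. \<forall>y\<in>K. d x y \<le> 4)"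
proof (cases "K \<subseteq> V")
  case True
  have "(x \<noteq> y \<longrightarrow> {x, y} \<in> gedges G) \<longleftrightarrow> d x y \<le> 4" if "x \<in> K" "y \<in> K" for x y
    using edge_iff[of x y] refl[of x] True that V_nodes by (cases "x = y") auto
  then show ?thesis using True unfolding clique_def by blast
qed (simp add: clique_def)

lemma clique_insert:
  assumes "clique G X" "a \<in> common_nbrs X"
  shows "clique G (insert a X)"
proof -
  have a: "a \<in> V" "\<And>x. x \<in> X \<Longrightarrow> d a x \<le> 4" using assms by (auto simp: common_nbrs_def)
  then have "d x a \<le> 4" if "x \<in> X" for x
    using sym[of x a] V_nodes that assms(1) by (auto simp: clique_iff)
  then show ?thesis using a assms(1) V_nodes by (auto simp: clique_iff)
qed

lemma saturated_clique_intersection: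
  assumes "clique_intersection G X"
  shows "saturated X"
  unfolding saturated_def
proof (intro ballI impI)
  fix u assume u: "u \<in> V" "\<forall>a\<in>common_nbrs X. d u a \<le> 4"
  obtain F where F: "\<forall>K\<in>F. maximal_clique G K" "X = \<Inter>F"
    using assms by (auto simp: clique_intersection_def)
  have "u \<in> K" if K: "K \<in> F" for K
  proof -
    have max: "maximal_clique G K" and cl: "clique G K" using F K by (auto simp: maximal_clique_def)
    have "K \<subseteq> common_nbrs X" using cl F K by (auto simp: common_nbrs_def clique_iff)
    then have "u \<in> common_nbrs K" using u by (auto simp: common_nbrs_def)
    then have "insert u K = K" using clique_insert[OF cl] max by (auto simp: maximal_clique_def)
    then show ?thesis by blast
  qed
  then show "u \<in> X" using F by blast
qed

text \<open>A maximal clique through \<open>v\<close>, \<open>a\<close>, \<open>u\<close> shares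
  \<open>a\<close> with one that contains \<open>X\<close> and \<open>a\<close>, so by
  \<open>free_vertex_cliques\<close> it contains \<open>X\<close>. From here on freeness is used
  only through \<open>separates\<close> and membership in \<open>X\<close>.\<close>

lemma free_vertex_separates:
  assumes X: "clique_intersection G X" and free: "free_vertex G X v" and ne: "X \<noteq> {v}"
  shows "separates v X"
  unfolding separates_def
proof (intro conjI ballI impI)
  have cl: "clique G X" using clique_intersection_clique X by blast
  show v: "v \<in> X" using free by (simp add: free_vertex_def)
  show "X \<subseteq> V" using cl by (simp add: clique_iff)
  show "d x y \<le> 4" if "x \<in> X" "y \<in> X" for x y using cl that by (simp add: clique_iff)
  fix a u assume a: "a \<in> common_nbrs X" "a \<noteq> v" and u: "u \<in> V" "u \<noteq> v" "d u v \<le> 4" "d u a \<le> 4"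
  obtain K where K: "maximal_clique G K" "insert a X \<subseteq> K"
    using maximal_clique_extends[OF finite_V clique_insert[OF cl a(1)]] by blast
  have N: "u \<in> N" "v \<in> N" "a \<in> N" "a \<in> V" "v \<in> V"
    using u a v \<open>X \<subseteq> V\<close> V_nodes common_nbrs_V by auto
  have "clique G {v, a, u}"
    using u a v N sym[of u v] sym[of u a] sym[of a v] by (auto simp: clique_iff common_nbrs_def)
  then obtain K' where K': "maximal_clique G K'" "{v, a, u} \<subseteq> K'"
    using maximal_clique_extends[OF finite_V] by blast
  have "X \<subseteq> K'"
  proof (rule ccontr)
    assume "\<not> X \<subseteq> K'"
    then have "K \<inter> K' = {v}" using free_vertex_cliques[OF finite_V X free K(1) _ K'(1)] K K' by blast
    then show False using K K' a by blast
  qed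
  moreover have "clique G K'" using K' by (simp add: maximal_clique_def)
  ultimately show "u \<in> common_nbrs X" using K' u by (auto simp: common_nbrs_def clique_iff)
qed (fact ne)

lemma maximal_common_nbrs:
  assumes "maximal_clique G X" "a \<in> common_nbrs X"
  shows "a \<in> X"
  using clique_insert[of X a] assms by (auto simp: maximal_clique_def)

end

section \<open>The four assertions for one clique-intersection\<close>

locale optimal_clique_intersection = optimal_root +
  fixes X x1 x2 D
  assumes ci: "clique_intersection G X"
    and ends: "x1 \<in> X" "x2 \<in> X" "d x1 x2 = D"
    and diam_le: "\<And>x y. \<lbrakk>x \<in> X; y \<in> X\<rbrakk> \<Longrightarrow> d x y \<le> D"
begin

lemma X_V: "X \<subseteq> V" and X_le4: "\<lbrakk>x \<in> X; y \<in> X\<rbrakk> \<Longrightarrow> d x y \<le> 4"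
  using clique_intersection_clique(1)[OF ci] by (auto simp: clique_iff)

sublocale spanned_tree N d X x1 x2 D
  by unfold_locales (use X_V VN ends diam_le in auto)

lemma X_N: "x \<in> X \<Longrightarrow> x \<in> N"
  using X by blast

lemma D_le4: "D \<le> 4"
  using X_le4 ends by blast

abbreviation "T \<equiv> metric_graph N d"
abbreviation "free v \<equiv> free_vertex G X v"

lemma free_X: "free v \<Longrightarrow> v \<in> X"
  by (simp add: free_vertex_def)

lemma free_eccentric:
  assumes "free v"
  shows "\<exists>y\<in>X. d v y = D"
proof (cases "X = {v}")
  case True
  then show ?thesis using ends by auto
next
  case False
  then obtain y where "y \<in> X" "D \<le> d v y"
    using separator_eccentric[OF free_vertex_separates[OF ci assms]] ends by blast
  then show ?thesis using diam_le[of v y] free_X[OF assms] by (intro bexI[of _ y]) auto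
qed

lemma separates_free: "\<lbrakk>free v; D > 0\<rbrakk> \<Longrightarrow> separates v X"
  using free_vertex_separates[OF ci] ends X_N by fastforce

lemma free_leaf:
  assumes "free v"
  shows "gleaf S v" "gecc S v = gdiam S"
proof -
  obtain y where y: "y \<in> X" "d v y = D" using free_eccentric[OF assms] by blast
  have vX: "v \<in> X" using free_X assms by blast
  show "gleaf S v" using gleaf_S vX y by blast
  have "gecc S v = D" using ecc_eqI[OF XH[OF vX] _ y] diam_le vX by blast
  then show "gecc S v = gdiam S" using gdiam_S by simp
qed

lemma even_center:
  assumes "D = 2 * r"
  shows "\<exists>c\<in>N. d x1 c = r \<and> d c x2 = r \<and> gcenter S = {c} \<and> (\<forall>x\<in>X. d c x \<le> r)"
proof -
  obtain c where c: "c \<in> N" "d x1 c = r" "d c x2 = r"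
    using between[of x1 x2 r] ends X_N assms by auto
  have "d c x \<le> r" if "x \<in> X" for x using mid_dist[OF c(1) _ that] c assms by simp
  then show ?thesis using c gcenter_even[OF c assms] by blast
qed

lemma odd_center:
  assumes "D = Suc (2 * r)"
  shows "\<exists>c1\<in>N. \<exists>c2\<in>N. d c1 c2 = 1 \<and> d c2 c1 = 1 \<and> gcenter S = {c1, c2} \<and>
    (\<forall>x\<in>X. d c1 x \<le> Suc r) \<and> (\<forall>x\<in>X. d c2 x \<le> Suc r)"
proof -
  obtain c1 where c1: "c1 \<in> N" "d x1 c1 = r" "d c1 x2 = Suc r"
    using between[of x1 x2 r] ends X_N assms by auto
  obtain c2 where c2: "c2 \<in> N" "d c1 c2 = 1" "d c2 x2 = r"
    using between[of c1 x2 1] ends X_N c1 by auto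
  have "d x1 c2 \<le> Suc r" "D \<le> d x1 c2 + r"
    using triangle[of x1 c2 c1] triangle[of x1 x2 c2] c1 c2 ends X_N by auto
  then have c2': "d x1 c2 = Suc r" using assms by simp
  have "d c1 x \<le> Suc r" "d c2 x \<le> Suc r" if "x \<in> X" for x
    using mid_dist[OF c1(1) _ that] mid_dist[OF c2(1) _ that] c1 c2 c2' assms by auto
  moreover have "d c2 c1 = 1" using sym c1 c2 by simp
  ultimately show ?thesis
    using c1(1) c2(1,2) gcenter_odd[OF c1(1) c2(1) c1(2) c2(2,3) assms] by blast
qed

text \<open>A partner \<open>y\<close> at distance three keeps \<open>v\<close> at least one away
  from both center nodes, the radius keeps it within two, and parity makes the two distances
  differ.\<close>

lemma free_near_center3:
  assumes D: "D = 3" and v: "free v"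
    and c: "c1 \<in> N" "c2 \<in> N" "d c1 c2 = 1"
    and near: "\<forall>x\<in>X. d c1 x \<le> 2" "\<forall>x\<in>X. d c2 x \<le> 2"
  shows "d v c1 = 1 \<and> d v c2 = 2 \<or> d v c1 = 2 \<and> d v c2 = 1"
proof -
  obtain y where y: "y \<in> X" "d v y = 3" using free_eccentric[OF v] D by blast
  have vX: "v \<in> X" using free_X v by blast
  have N: "v \<in> N" "y \<in> N" using X_N y vX by auto
  have "3 \<le> d v c1 + d c1 y" "3 \<le> d v c2 + d c2 y" using triangle[of v y] N c y by force+
  moreover have "d c1 y \<le> 2" "d c2 y \<le> 2" "d v c1 \<le> 2" "d v c2 \<le> 2"
    using near y(1) vX sym[of v c1] sym[of v c2] N c by auto
  moreover have "even (d v c1 + 1 + d v c2)" using parity[of v c1 c2] N c by simp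
  ultimately show ?thesis by presburger
qed

lemma gdist_T: "\<lbrakk>x \<in> N; y \<in> N\<rbrakk> \<Longrightarrow> gdist T x y = d x y"
  by (rule gdist_metric_graph)

lemma gdist_set_pair:
  assumes "v \<in> N" "c1 \<in> N" "c2 \<in> N" "d v c1 \<le> d v c2"
  shows "gdist T v c1 = gdist_set T v {c1, c2}" "gdist T v c1 = gdist_set T v {c2, c1}"
  using assms by (simp_all add: gdist_set_def gdist_T min_absorb1 min_absorb2)

lemma common_center:
  "\<exists>c \<in> gcenter S. \<exists>w. \<forall>v. free v \<and> v \<noteq> w \<longrightarrow> gdist T v c = gdist_set T v (gcenter S)"
proof (cases "even D")
  case True
  then obtain r where "D = 2 * r" by blast
  then obtain c where "gcenter S = {c}" using even_center by blast
  then show ?thesis by (simp add: gdist_set_def)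
next
  case False
  then obtain r where r: "D = Suc (2 * r)" using oddE by fastforce
  obtain c1 c2 where c: "c1 \<in> N" "c2 \<in> N" "d c1 c2 = 1" "d c2 c1 = 1" "gcenter S = {c1, c2}"
    and near: "\<forall>x\<in>X. d c1 x \<le> Suc r" "\<forall>x\<in>X. d c2 x \<le> Suc r"
    using odd_center[OF r] by blast
  have "\<exists>c\<in>{c1, c2}. \<exists>w. \<forall>v. free v \<and> v \<noteq> w \<longrightarrow> d v c \<le> d v c1 \<and> d v c \<le> d v c2"
  proof (cases "r = 0")
    case True
    \<comment> \<open>In diameter one \<open>c2\<close> may itself be free; it is then the
      exception.\<close>
    have "d v c1 \<le> d v c2" if v: "free v" "v \<noteq> c2" for v
    proof -
      have "v \<in> N" "d c1 v \<le> 1" using X_N free_X v near True by auto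
      then have "d v c1 \<le> 1" "d v c2 \<noteq> 0" using sym[of v c1] zero_iff[of v c2] v c by auto
      then show ?thesis by simp
    qed
    then show ?thesis by (intro bexI[of _ c1] exI[of _ c2]) auto
  next
    case False
    then have D3: "D = 3" "r = 1" using r D_le4 by auto
    have close: "d v c1 = 1 \<and> d v c2 = 2 \<or> d v c1 = 2 \<and> d v c2 = 1" if "free v" for v
      using free_near_center3[OF D3(1) that c(1-3)] near D3(2) by (simp add: numeral_2_eq_2)
    show ?thesis
    proof (rule ccontr)
      assume no: "\<not> ?thesis"
      \<comment> \<open>If each center node fails for more than one free vertex, then each is
        strictly nearer to two of them, which \<open>free_not_spread\<close> excludes.\<close>
      have "\<forall>w. \<exists>v. free v \<and> v \<noteq> w \<and> \<not> (d v c1 \<le> d v c1 \<and> d v c1 \<le> d v c2)"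
        and "\<forall>w. \<exists>v. free v \<and> v \<noteq> w \<and> \<not> (d v c2 \<le> d v c1 \<and> d v c2 \<le> d v c2)"
        using no by blast+
      then obtain w1 w2 v1 v2 where
        w: "free w1" "free w2" "w1 \<noteq> w2" "\<not> d w1 c1 \<le> d w1 c2" "\<not> d w2 c1 \<le> d w2 c2" and
        v: "free v1" "free v2" "v1 \<noteq> v2" "\<not> d v1 c2 \<le> d v1 c1" "\<not> d v2 c2 \<le> d v2 c1"
        by (metis order.refl)
      have "d w1 c1 = 2 \<and> d w1 c2 = 1" "d w2 c1 = 2 \<and> d w2 c2 = 1"
        "d v1 c1 = 1 \<and> d v1 c2 = 2" "d v2 c1 = 1 \<and> d v2 c2 = 2"
        using close w v by fastforce+
      moreover have "separates u X" if "free u" for u using separates_free[OF that] D3 by simp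
      ultimately show False
        using free_not_spread[of v1 X v2 w1 w2 c1 c2] w v c near D3(2) by (simp add: numeral_2_eq_2)
    qed
  qed
  then obtain c w where cw: "c = c1 \<or> c = c2"
    "\<And>v. \<lbrakk>free v; v \<noteq> w\<rbrakk> \<Longrightarrow> d v c \<le> d v c1 \<and> d v c \<le> d v c2" by blast
  have "gdist T v c = gdist_set T v {c1, c2}" if "free v" "v \<noteq> w" for v
    using gdist_set_pair[of v c1 c2] gdist_set_pair[of v c2 c1] cw(2)[OF that] cw(1) X_N free_X that c
    by auto
  then show ?thesis using cw(1) c(5) by (intro bexI[of _ c] exI[of _ w]) auto
qed

text \<open>An internal node forces distance at least two between \<open>v\<close> and the head of
  the path. For \<open>D \<le> 2\<close> the radius forbids this; for \<open>D = 3\<close> the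
  internal node would be the second center node, which the path must not meet. For
  \<open>D = 4\<close> it is the middle node treated above.\<close>

lemma path_internal_nodes:
  assumes v: "free v" and p: "gpath T p" "set p \<inter> gcenter S = {hd p}" "last p = v"
    and x: "x \<in> set p - {hd p, last p}"
  shows "steiner_node G T x \<and> gdegree T x = 2"
proof -
  have pN: "set p \<subseteq> N" using p(1) by (auto simp: gpath_def gwalk_def metric_graph_def)
  define h where "h = hd p"
  have h: "h \<in> gcenter S" "h \<in> set p" using p(2) h_def by auto
  have vp: "v \<in> set p" using p(3) x by (metis DiffE empty_iff last_in_set list.set(1))
  have N: "h \<in> N" "x \<in> N" "v \<in> N" using pN h x vp by auto
  have "d h x \<noteq> 0" "d x v \<noteq> 0" using zero_iff N x h_def p(3) by auto
  moreover have btw: "d h x + d x v = d h v" using path_between[OF p(1), of x] x h_def p(3) by simp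
  ultimately have hv: "2 \<le> d h v" "0 < d h x" "0 < d x v" by auto
  have vX: "v \<in> X" using free_X v by blast
  have xc: "x \<notin> gcenter S" using p(2) x by blast
  have vc: "v \<notin> gcenter S"
  proof
    assume "v \<in> gcenter S"
    then have "v = h" using p(2) vp h_def by blast
    then show False using hv N by simp
  qed
  have D4: "D = 4"
  proof (rule ccontr)
    assume "D \<noteq> 4"
    then consider "D = 2 * 0" | "D = 2 * 1" | "D = Suc (2 * 0)" | "D = Suc (2 * 1)"
      using D_le4 by linarith
    then show False
    proof cases
      case 1
      then show ?thesis using even_center[OF 1] h(1) hv(1) vX by force
    next
      case 2
      then show ?thesis using even_center[OF 2] h(1) hv(1) vX by force
    next
      case 3
      then show ?thesis using odd_center[OF 3] h(1) hv(1) vX by force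
    next
      case 4
      then have D3: "D = 3" by simp
      obtain c1 c2 where c: "c1 \<in> N" "c2 \<in> N" "d c1 c2 = 1" "d c2 c1 = 1" "gcenter S = {c1, c2}"
        "\<forall>x\<in>X. d c1 x \<le> 2" "\<forall>x\<in>X. d c2 x \<le> 2"
        using odd_center[OF 4] by (auto simp: numeral_2_eq_2)
      have "\<exists>h'. h' \<in> gcenter S \<and> h' \<in> N \<and> d h h' = 1 \<and> d h v = 2 \<and> d h' v = 1"
        using free_near_center3[OF D3 v c(1,2,3,6,7)] h(1) c hv sym[of v c1] sym[of v c2] N by auto
      then obtain h' where h': "h' \<in> gcenter S" "h' \<in> N" "d h h' = 1" "d h v = 2" "d h' v = 1" by blast
      then have "d h x = 1" "d x v = 1" using btw hv by auto
      \<comment> \<open>Both \<open>x\<close> and \<open>h'\<close> are midpoints between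
        \<open>h\<close> and \<open>v\<close>, and a midpoint in a tree is unique.\<close>
      then have "d x h' = 0"
        using four_point[of x h' h v] sym[of x h] sym[of h' h] N h' by auto
      then show ?thesis using zero_iff N h' xc by blast
    qed
  qed
  then have "D = 2 * 2" by simp
  then obtain c where c: "c \<in> N" "d x1 c = 2" "d c x2 = 2" "gcenter S = {c}"
    and near: "\<forall>x\<in>X. d c x \<le> 2" using even_center by blast
  have hc: "h = c" using h c by simp
  have sep: "separates v X" using separates_free[OF v] D4 by simp
  have ends4: "d x1 x2 = 4" using ends D4 by simp
  have "d v x = 1" "d x c = 1"
    using btw hv near vX hc sym[of v x] sym[of x c] N by auto
  note mid = sep saturated_clique_intersection[OF ci] ends(1,2) ends4 c(1-3) N(2) this
  have "x \<notin> V" by (rule mid_steiner[OF mid])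
  moreover have "card {u \<in> N. d x u = 1} = 2" by (rule mid_degree[OF mid])
  ultimately show ?thesis
    using N(2) gdegree_metric_graph by (simp add: steiner_node_def metric_graph_def)
qed

text \<open>The vertex from \<open>far_nbr\<close> belongs to \<open>X\<close>, since a maximal
  clique contains all its common neighbours. A one-vertex clique spans a single node of diameter
  zero, whence \<open>card X \<ge> 2\<close>.\<close>

lemma maximal_diam:
  assumes "maximal_clique G X" "card X \<ge> 2" "free v"
  shows "gdiam S = 4"
proof -
  have "X \<noteq> {v}" using assms(2) by auto
  then have sep: "separates v X" using free_vertex_separates[OF ci assms(3)] by blast
  obtain a where a: "a \<in> nbrs v X" "d v a = 4" using far_nbr[OF sep] by blast
  then have "a \<in> X" using maximal_common_nbrs[OF assms(1)] by (simp add: nbrs_def)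
  then have "4 \<le> D" using diam_le[of v a] a free_X[OF assms(3)] by simp
  then show ?thesis using D_le4 gdiam_S by simp
qed

end

lemma optimal_root_exists:
  fixes G :: "'a::infinite ugraph"
  assumes "steiner_power 4 G"
  shows "\<exists>N d. optimal_root G N d"
proof -
  obtain T where T: "steiner_root 4 G T" using assms by (auto simp: steiner_power_def)
  then have "root_metric G (gverts T) (gdist T)"
    using gtree_tree_metric(1)[of T] by (simp add: steiner_root_def root_metric_def)
  then have ne: "(gverts T, gdist T) \<in> {(N, d). root_metric G N d}" by simp
  have "wf (root_order G)" by (simp add: root_order_def)
  then obtain z where z: "z \<in> {(N, d). root_metric G N d}"
    "\<And>y. (y, z) \<in> root_order G \<Longrightarrow> y \<notin> {(N, d). root_metric G N d}"
    using wfE_min[OF _ ne] by metis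
  then have "optimal_root G (fst z) (snd z)" by unfold_locales auto
  then show ?thesis by blast
qed

text \<open>If there is no exception, any element may serve as \<open>w\<close>. Letting the path
  meet the center only at its head keeps a second center node from counting as internal.\<close>

theorem theorem4p2:
  fixes G :: "'a::infinite ugraph"
  assumes "steiner_power 4 G"
  shows "\<exists>T. steiner_root 4 G T \<and>
    (\<forall>X. clique_intersection G X \<longrightarrow>
      (\<forall>v. free_vertex G X v \<longrightarrow>
         gleaf (spanned_subtree T X) v \<and>
         gecc (spanned_subtree T X) v = gdiam (spanned_subtree T X)) \<and>
      (\<exists>c \<in> gcenter (spanned_subtree T X). \<exists>w. \<forall>v. free_vertex G X v \<and> v \<noteq> w \<longrightarrow>
         gdist T v c = gdist_set T v (gcenter (spanned_subtree T X))) \<and>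
      (\<forall>v p. free_vertex G X v \<and> gpath T p \<and>
         set p \<inter> gcenter (spanned_subtree T X) = {hd p} \<and> last p = v \<longrightarrow>
         (\<forall>x \<in> set p - {hd p, last p}. steiner_node G T x \<and> gdegree T x = 2)) \<and>
      (maximal_clique G X \<and> card X \<ge> 2 \<and> (\<exists>v. free_vertex G X v) \<longrightarrow>
         gdiam (spanned_subtree T X) = 4))"
proof -
  obtain N d where "optimal_root G N d" using optimal_root_exists[OF assms] by blast
  then interpret optimal_root G N d .
  let ?T = "metric_graph N d"
  have "steiner_root 4 G ?T"
    using gtree_metric_graph VN gdist_metric_graph edge_iff V_nodes
    by (simp add: steiner_root_def) (simp add: metric_graph_def)
  moreover have
    "(\<forall>v. free_vertex G X v \<longrightarrow>
         gleaf (spanned_subtree ?T X) v \<and>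
         gecc (spanned_subtree ?T X) v = gdiam (spanned_subtree ?T X)) \<and>
      (\<exists>c \<in> gcenter (spanned_subtree ?T X). \<exists>w. \<forall>v. free_vertex G X v \<and> v \<noteq> w \<longrightarrow>
         gdist ?T v c = gdist_set ?T v (gcenter (spanned_subtree ?T X))) \<and>
      (\<forall>v p. free_vertex G X v \<and> gpath ?T p \<and>
         set p \<inter> gcenter (spanned_subtree ?T X) = {hd p} \<and> last p = v \<longrightarrow>
         (\<forall>x \<in> set p - {hd p, last p}. steiner_node G ?T x \<and> gdegree ?T x = 2)) \<and>
      (maximal_clique G X \<and> card X \<ge> 2 \<and> (\<exists>v. free_vertex G X v) \<longrightarrow>
         gdiam (spanned_subtree ?T X) = 4)"
    if X: "clique_intersection G X" for X
  proof -
    let ?I = "(\<lambda>(x, y). d x y) ` (X \<times> X)"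
    have "X \<subseteq> V" "X \<noteq> {}"
      using clique_intersection_clique[OF X] by (auto simp: clique_iff)
    then have "finite X" using finite_V finite_subset by blast
    then have I: "finite ?I" "?I \<noteq> {}" using \<open>X \<noteq> {}\<close> by auto
    obtain x1 x2 where x12: "x1 \<in> X" "x2 \<in> X" "Max ?I = d x1 x2" using Max_in[OF I] by auto
    have "d x y \<le> d x1 x2" if "x \<in> X" "y \<in> X" for x y
      using Max_ge[OF I(1), of "d x y"] x12(3) that by force
    then interpret optimal_clique_intersection G N d X x1 x2 "d x1 x2"
      using X x12 by unfold_locales auto
    show ?thesis using free_leaf common_center path_internal_nodes maximal_diam by blast
  qed
  ultimately show ?thesis by blast
qed

end
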